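(* Let $X$ and $Y$ be complex Banach spaces, $A\in\mathcal{B}(X)$, $B\in\mathcal{B}(Y)$. If $A$ and $B$ are decomposable, then for every $C\in\mathcal{B}(Y,X)$, $$\sigma_{gK}(M_C)=\sigma_{gK}(A)\cup\sigma_{gK}(B),$$ where $M_C=\begin{pmatrix}A & C\\ 0 & B\end{pmatrix}\in\mathcal{B}(X\oplus Y)$. In particular, this equality holds if $A$ and $B$ are algebraic or compact.
   Context: $\mathcal{B}(X)$ is the algebra of bounded linear operators on $X$, and $\mathcal{B}(Y,X)$ the space of bounded linear operators from $Y$ to $X$. $M_C$ acts on $X\oplus Y$ by $M_C(x,y)=(Ax+Cy,By)$. $N(T)$, $R(T)$ are the null space and range of $T$, and $R^{\infty}(T)=\bigcap_{n\ge 0}R(T^n)$. A bounded operator $T$ on a Banach space $Z$ is semi-regular (Kato) if $R(T)$ is closed and $N(T)\subseteq R^\infty(T)$. $T$ is Pseudo-Fredholm (admits a generalized Kato decomposition) if there are $T$-invariant closed subspaces $M,N$ with $Z=M\oplus N$, $T|_M$ semi-regular and $T|_N$ quasinilpotent (here $M=\{0\}$ or $N=\{0\}$ is allowed). $\sigma_{gK}(T)=\{\lambda\in\mathbb{C}: T-\lambda I \text{ is not Pseudo-Fredholm}\}$. $T\in\mathcal{B}(Z)$ is decomposable if for any open covering $\{U_1,U_2\}$ of $\mathbb{C}$ there are closed $T$-invariant subspaces $Z_1,Z_2$ of $Z$ with $Z_1+Z_2=Z$ and $\sigma(T|_{Z_k})\subset U_k$ for $k=1,2$. $T$ is algebraic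 if $p(T)=0$ for some nonzero complex polynomial $p$. *)

theory Defs
  imports "HOL-Analysis.Analysis" "HOL-Computational_Algebra.Polynomial"
begin

class complex_normed_vector = real_normed_vector +
  fixes scaleC :: "complex \<Rightarrow> 'a \<Rightarrow> 'a"  (infixr \<open>*\<^sub>C\<close> 75)
  assumes scaleC_add_right: "c *\<^sub>C (x + y) = c *\<^sub>C x + c *\<^sub>C y"
    and scaleC_add_left: "(c + d) *\<^sub>C x = c *\<^sub>C x + d *\<^sub>C x"
    and scaleC_scaleC: "c *\<^sub>C (d *\<^sub>C x) = (c * d) *\<^sub>C x"
    and scaleC_of_real: "complex_of_real r *\<^sub>C x = r *\<^sub>R x"
    and norm_scaleC: "norm (c *\<^sub>C x) = cmod c * norm x"

class complex_banach = complex_normed_vector + banach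

lemma scaleC_one: "1 *\<^sub>C x = (x :: 'a::complex_normed_vector)"
  using scaleC_of_real[of 1 x] by simp

global_interpretation complex_vector:
  vector_space "scaleC :: complex \<Rightarrow> 'a \<Rightarrow> 'a::complex_normed_vector"
  by unfold_locales (simp_all add: scaleC_add_right scaleC_add_left scaleC_scaleC scaleC_one)

instantiation complex :: complex_normed_vector
begin

definition scaleC_complex :: "complex \<Rightarrow> complex \<Rightarrow> complex"
  where "scaleC_complex c x = c * x"

instance
  by standard (simp_all add: scaleC_complex_def algebra_simps norm_mult scaleR_conv_of_real)

end

instance complex :: complex_banach ..

text \<open>The direct sum \<open>X \<oplus> Y\<close> is the product type. It carries the Euclidean combination of the
  two norms, which is equivalent to any other usual choice.\<close>

instantiation prod :: (complex_normed_vector, complex_normed_vector) complex_normed_vector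
begin

definition scaleC_prod :: "complex \<Rightarrow> 'a \<times> 'b \<Rightarrow> 'a \<times> 'b"
  where "scaleC_prod c z = (c *\<^sub>C fst z, c *\<^sub>C snd z)"

instance
proof
  fix c d :: complex and r :: real and x y :: "'a \<times> 'b"
  show "c *\<^sub>C (x + y) = c *\<^sub>C x + c *\<^sub>C y"
    by (simp add: scaleC_prod_def scaleC_add_right)
  show "(c + d) *\<^sub>C x = c *\<^sub>C x + d *\<^sub>C x"
    by (simp add: scaleC_prod_def scaleC_add_left)
  show "c *\<^sub>C (d *\<^sub>C x) = (c * d) *\<^sub>C x"
    by (simp add: scaleC_prod_def scaleC_scaleC)
  show "complex_of_real r *\<^sub>C x = r *\<^sub>R x"
    by (simp add: scaleC_prod_def scaleC_of_real prod_eq_iff)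
  have "sqrt ((cmod c * norm (fst x))\<^sup>2 + (cmod c * norm (snd x))\<^sup>2)
      = sqrt ((cmod c)\<^sup>2 * ((norm (fst x))\<^sup>2 + (norm (snd x))\<^sup>2))"
    by (simp add: power_mult_distrib distrib_left)
  also have "\<dots> = cmod c * sqrt ((norm (fst x))\<^sup>2 + (norm (snd x))\<^sup>2)"
    by (simp add: real_sqrt_mult)
  finally show "norm (c *\<^sub>C x) = cmod c * norm x"
    by (simp add: scaleC_prod_def norm_prod_def norm_scaleC)
qed

end

instance prod :: (complex_banach, complex_banach) complex_banach ..

definition bounded_clinear ::
    "('a::complex_normed_vector \<Rightarrow> 'b::complex_normed_vector) \<Rightarrow> bool"
  where "bounded_clinear T \<longleftrightarrow> bounded_linear T \<and> (\<forall>c x. T (c *\<^sub>C x) = c *\<^sub>C T x)"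

definition upper_triangular_op ::
    "('a::complex_normed_vector \<Rightarrow> 'a) \<Rightarrow> ('b::complex_normed_vector \<Rightarrow> 'b) \<Rightarrow>
     ('b \<Rightarrow> 'a) \<Rightarrow> 'a \<times> 'b \<Rightarrow> 'a \<times> 'b"
  where "upper_triangular_op A B C = (\<lambda>(x, y). (A x + C y, B y))"

definition shift_op ::
    "('a::complex_normed_vector \<Rightarrow> 'a) \<Rightarrow> complex \<Rightarrow> 'a \<Rightarrow> 'a"
  where "shift_op T l = (\<lambda>x. T x - l *\<^sub>C x)"

definition closed_invariant_subspace ::
    "('a::complex_normed_vector \<Rightarrow> 'a) \<Rightarrow> 'a set \<Rightarrow> bool"
  where "closed_invariant_subspace T M \<longleftrightarrow>
    complex_vector.subspace M \<and> closed M \<and> T ` M \<subseteq> M"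

text \<open>The notions suffixed \<open>_on\<close> describe the restriction of \<open>T\<close> to \<open>M\<close> as an operator on the
  normed space \<open>M\<close>; they are meant for a closed \<open>T\<close>-invariant subspace \<open>M\<close>.
  The inverse \<open>S\<close> below is only required to be bounded on \<open>M\<close>: an inverse of a linear bijection
  of \<open>M\<close> is automatically linear.\<close>

definition invertible_on :: "'a::complex_normed_vector set \<Rightarrow> ('a \<Rightarrow> 'a) \<Rightarrow> bool"
  where "invertible_on M T \<longleftrightarrow>
    (\<exists>S. S ` M \<subseteq> M \<and> (\<forall>x\<in>M. S (T x) = x \<and> T (S x) = x) \<and>
         (\<exists>K. \<forall>x\<in>M. norm (S x) \<le> K * norm x))"

definition spectrum_on :: "'a::complex_normed_vector set \<Rightarrow> ('a \<Rightarrow> 'a) \<Rightarrow> complex set"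
  where "spectrum_on M T = {l. \<not> invertible_on M (shift_op T l)}"

text \<open>An inclusion rather than an equality, since the spectrum is empty when \<open>M = {0}\<close>.\<close>

definition quasinilpotent_on :: "'a::complex_normed_vector set \<Rightarrow> ('a \<Rightarrow> 'a) \<Rightarrow> bool"
  where "quasinilpotent_on M T \<longleftrightarrow> spectrum_on M T \<subseteq> {0}"

definition semi_regular_on :: "'a::complex_normed_vector set \<Rightarrow> ('a \<Rightarrow> 'a) \<Rightarrow> bool"
  where "semi_regular_on M T \<longleftrightarrow>
    closed (T ` M) \<and> {x \<in> M. T x = 0} \<subseteq> (\<Inter>n. (T ^^ n) ` M)"

definition pseudo_fredholm :: "('a::complex_normed_vector \<Rightarrow> 'a) \<Rightarrow> bool"
  where "pseudo_fredholm T \<longleftrightarrow>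
    (\<exists>M N. closed_invariant_subspace T M \<and> closed_invariant_subspace T N \<and>
       {x + y | x y. x \<in> M \<and> y \<in> N} = UNIV \<and> M \<inter> N = {0} \<and>
       semi_regular_on M T \<and> quasinilpotent_on N T)"

definition gK_spectrum :: "('a::complex_normed_vector \<Rightarrow> 'a) \<Rightarrow> complex set"
  where "gK_spectrum T = {l. \<not> pseudo_fredholm (shift_op T l)}"

definition decomposable_op :: "('a::complex_normed_vector \<Rightarrow> 'a) \<Rightarrow> bool"
  where "decomposable_op T \<longleftrightarrow>
    (\<forall>U1 U2. open U1 \<and> open U2 \<and> U1 \<union> U2 = UNIV \<longrightarrow>
      (\<exists>Z1 Z2. closed_invariant_subspace T Z1 \<and> closed_invariant_subspace T Z2 \<and>
         {x + y | x y. x \<in> Z1 \<and> y \<in> Z2} = UNIV \<and>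
         spectrum_on Z1 T \<subseteq> U1 \<and> spectrum_on Z2 T \<subseteq> U2))"

definition poly_op ::
    "complex poly \<Rightarrow> ('a::complex_normed_vector \<Rightarrow> 'a) \<Rightarrow> 'a \<Rightarrow> 'a"
  where "poly_op p T = (\<lambda>x. \<Sum>i\<le>degree p. coeff p i *\<^sub>C (T ^^ i) x)"

definition algebraic_op :: "('a::complex_normed_vector \<Rightarrow> 'a) \<Rightarrow> bool"
  where "algebraic_op T \<longleftrightarrow> (\<exists>p. p \<noteq> 0 \<and> poly_op p T = (\<lambda>x. 0))"

definition compact_op ::
    "('a::complex_normed_vector \<Rightarrow> 'b::complex_normed_vector) \<Rightarrow> bool"
  where "compact_op T \<longleftrightarrow> (\<forall>S. bounded S \<longrightarrow> compact (closure (T ` S)))"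

end

theory Submission
  imports Defs
begin

text \<open>
  Every operator of the three kinds in question (decomposable, algebraic, compact) has two
  properties at each complex number \<open>l\<close>. First, \<open>T - l\<close> admits no bounded chain that starts at a
  nonzero vector, where a chain is a sequence with \<open>(T - l) (x 0) = 0\<close>,
  \<open>(T - l) (x (n + 1)) = x n\<close> and geometrically bounded norms; this is the single-valued extension
  property. Secondly, if \<open>T - l\<close> is bounded below, then it is onto. Operators with both properties are
  called tame here. Decomposable operators are tame by a suitable choice of the two open sets
  (\<open>decomposable_tame\<close>); algebraic and compact operators are tame because they have only countably many
  approximate eigenvalues (\<open>countable_approximate_point_spectrum_tame\<close>).

  For a tame operator the generalized Kato spectrum is the set of accumulation points of the ordinary
  spectrum (\<open>gK_spectrum_tame\<close>). Indeed, in a generalized Kato decomposition of \<open>T - l\<close> a nonzero kernel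
  vector of the semi-regular part would start a bounded chain. So the semi-regular part is injective with
  closed range and therefore bounded below, also at the points near \<open>l\<close>; since the quasinilpotent part
  is invertible at all points other than \<open>l\<close>, it follows that \<open>T - m\<close> is bounded below, hence
  invertible, for \<open>m \<noteq> l\<close> near \<open>l\<close> (\<open>pseudo_fredholm_isolated\<close>). Conversely, at a point that is
  not an accumulation point of the spectrum the Riesz projection splits \<open>T - l\<close> into an invertible and a
  quasinilpotent part (\<open>isolated_pseudo_fredholm\<close>).

  Finally, the triangular operator inherits tameness from its diagonal entries, and its spectrum is
  the union of theirs (\<open>tame_upper_triangular_op\<close>, \<open>spectrum_upper_triangular_op\<close>). Accumulation points
  of a union of two sets are accumulation points of one of them, which gives the theorem.

  A recurring device is \<open>surj_on_connected\<close>: as long as \<open>T - l\<close> stays bounded below on an invariant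
  subspace, its surjectivity there does not change along a connected set of parameters \<open>l\<close>.
\<close>

section \<open>Operators on closed invariant subspaces\<close>

lemma bounded_bilinear_scaleC:
  "bounded_bilinear (scaleC :: complex \<Rightarrow> 'a::complex_normed_vector \<Rightarrow> 'a)"
proof
  fix c d :: complex and r :: real and x y :: 'a
  show "(c + d) *\<^sub>C x = c *\<^sub>C x + d *\<^sub>C x" by (rule scaleC_add_left)
  show "c *\<^sub>C (x + y) = c *\<^sub>C x + c *\<^sub>C y" by (rule scaleC_add_right)
  show "(r *\<^sub>R c) *\<^sub>C x = r *\<^sub>R (c *\<^sub>C x)"
    by (simp add: scaleR_conv_of_real scaleC_scaleC flip: scaleC_of_real)
  show "c *\<^sub>C (r *\<^sub>R x) = r *\<^sub>R (c *\<^sub>C x)"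
    by (simp add: scaleC_scaleC mult.commute flip: scaleC_of_real)
  show "\<exists>K. \<forall>c (x::'a). norm (c *\<^sub>C x) \<le> norm c * norm x * K"
    by (rule exI[of _ 1]) (simp add: norm_scaleC)
qed

lemmas continuous_on_scaleC [continuous_intros] =
  bounded_bilinear.continuous_on[OF bounded_bilinear_scaleC]

lemmas scaleC_diff_right = complex_vector.scale_right_diff_distrib
lemmas scaleC_diff_left = complex_vector.scale_left_diff_distrib

lemma bounded_clinear_linear: "bounded_clinear T \<Longrightarrow> bounded_linear T"
  and bounded_clinear_scaleC: "bounded_clinear T \<Longrightarrow> T (c *\<^sub>C x) = c *\<^sub>C T x"
  by (simp_all add: bounded_clinear_def)

lemma
  assumes "bounded_clinear T"
  shows bounded_clinear_add: "T (x + y) = T x + T y"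
    and bounded_clinear_diff: "T (x - y) = T x - T y"
    and bounded_clinear_minus: "T (- x) = - T x"
    and bounded_clinear_zero: "T 0 = 0"
  using bounded_clinear_linear[OF assms]
  by (simp_all add: bounded_linear.linear linear_add linear_diff linear_neg linear_0)

lemma bounded_clinear_continuous_on: "bounded_clinear T \<Longrightarrow> continuous_on S T"
  using bounded_clinear_linear linear_continuous_on by blast

lemma bounded_clinear_bound:
  assumes "bounded_clinear T"
  obtains K where "K > 0" "\<And>x. norm (T x) \<le> K * norm x"
  using bounded_linear.pos_bounded[OF bounded_clinear_linear[OF assms]]
  by (auto simp: mult.commute)

lemma bounded_clinear_scaleC_left: "bounded_clinear (\<lambda>x :: 'a::complex_normed_vector. c *\<^sub>C x)"
  unfolding bounded_clinear_def
  using bounded_bilinear.bounded_linear_right[OF bounded_bilinear_scaleC]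
  by (auto simp: scaleC_scaleC mult.commute)

lemma shift_op_apply: "shift_op T l x = T x - l *\<^sub>C x"
  by (simp add: shift_op_def)

lemma bounded_clinear_shift_op:
  assumes "bounded_clinear T"
  shows "bounded_clinear (shift_op T l)"
  unfolding bounded_clinear_def shift_op_def
  using bounded_clinear_linear[OF assms] bounded_clinear_scaleC[OF assms]
    bounded_linear_sub[OF _ bounded_bilinear.bounded_linear_right[OF bounded_bilinear_scaleC]]
  by (auto simp: scaleC_diff_right scaleC_scaleC mult.commute)

lemma shift_op_shift_op: "shift_op (shift_op T l) m = shift_op T (l + m)"
  by (simp add: shift_op_def scaleC_add_left algebra_simps)

lemma shift_op_zero: "shift_op T 0 = T"
  by (simp add: shift_op_def)

lemma shift_op_image_subset:
  assumes "T ` M \<subseteq> M" "complex_vector.subspace M"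
  shows "shift_op T l ` M \<subseteq> M"
  using assms
  by (auto simp: shift_op_def intro!: complex_vector.subspace_diff complex_vector.subspace_scale)

definition bounded_below_on ::
    "'a::complex_normed_vector set \<Rightarrow> ('a \<Rightarrow> 'b::complex_normed_vector) \<Rightarrow> bool"
  where "bounded_below_on M T \<longleftrightarrow> (\<exists>c>0. \<forall>x\<in>M. c * norm x \<le> norm (T x))"

lemma bounded_below_onI:
  "0 < c \<Longrightarrow> (\<And>x. x \<in> M \<Longrightarrow> c * norm x \<le> norm (T x)) \<Longrightarrow> bounded_below_on M T"
  by (auto simp: bounded_below_on_def)

lemma bounded_below_on_kernel:
  assumes "bounded_below_on M T" "x \<in> M" "T x = 0"
  shows "x = 0"
  using assms by (force simp: bounded_below_on_def mult_le_0_iff)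

lemma bounded_below_on_subset:
  "bounded_below_on M T \<Longrightarrow> M' \<subseteq> M \<Longrightarrow> bounded_below_on M' T"
  unfolding bounded_below_on_def by blast

text \<open>Surjectivity together with a lower bound is the form of invertibility used throughout: lower bounds
  pass to smaller subspaces and to direct sums, and surjectivity spreads along connected sets of
  parameters, whereas a chosen inverse would have to be carried along.\<close>
lemma invertible_on_iff:
  assumes T: "bounded_clinear T" and M: "complex_vector.subspace M" and TM: "T ` M \<subseteq> M"
  shows "invertible_on M T \<longleftrightarrow> bounded_below_on M T \<and> T ` M = M"
proof
  assume "invertible_on M T"
  then obtain S K where S: "S ` M \<subseteq> M" "\<And>x. x \<in> M \<Longrightarrow> S (T x) = x \<and> T (S x) = x"
    and K: "\<And>x. x \<in> M \<Longrightarrow> norm (S x) \<le> K * norm x"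
    unfolding invertible_on_def by blast
  have "bounded_below_on M T"
  proof (rule bounded_below_onI)
    show "0 < inverse (\<bar>K\<bar> + 1)" by simp
    fix x assume "x \<in> M"
    then have "T x \<in> M" using TM by blast
    have "norm x \<le> K * norm (T x)"
      using K[OF \<open>T x \<in> M\<close>] S(2)[OF \<open>x \<in> M\<close>] by simp
    also have "\<dots> \<le> (\<bar>K\<bar> + 1) * norm (T x)"
      by (rule mult_right_mono) auto
    finally show "inverse (\<bar>K\<bar> + 1) * norm x \<le> norm (T x)"
      by (simp add: field_simps)
  qed
  moreover have "M \<subseteq> T ` M"
    using S by (metis image_eqI image_subset_iff subsetI)
  ultimately show "bounded_below_on M T \<and> T ` M = M" using TM by blast
next
  assume *: "bounded_below_on M T \<and> T ` M = M"
  then obtain c where c: "c > 0" "\<And>x. x \<in> M \<Longrightarrow> c * norm x \<le> norm (T x)"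
    unfolding bounded_below_on_def by blast
  have inj: "inj_on T M"
  proof (rule inj_onI)
    fix x y assume xy: "x \<in> M" "y \<in> M" "T x = T y"
    then have "x - y \<in> M" "T (x - y) = 0"
      using M T by (auto simp: complex_vector.subspace_diff bounded_clinear_diff)
    then show "x = y" using bounded_below_on_kernel * by fastforce
  qed
  define S where "S = inv_into M T"
  have S: "S y \<in> M" "T (S y) = y" if "y \<in> M" for y
    using that * by (auto simp: S_def inv_into_into f_inv_into_f)
  have "norm (S y) \<le> inverse c * norm y" if "y \<in> M" for y
    using c(2)[OF S(1)[OF that]] S(2)[OF that] c(1) by (simp add: field_simps)
  moreover have "S (T x) = x" if "x \<in> M" for x
    using inj that by (simp add: S_def)
  ultimately show "invertible_on M T"
    unfolding invertible_on_def using S(1) S(2) by blast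
qed

text \<open>Solving \<open>U x + V x = y\<close> means finding a fixed point of \<open>x \<mapsto> U\<inverse> (y - V x)\<close>, which is a contraction
  with factor \<open>e / c\<close>. Working with the fixed point theorem on the complete set \<open>M\<close> replaces the
  Neumann series of operators on \<open>M\<close>.\<close>
lemma surj_perturb:
  fixes U V :: "'a::complex_banach \<Rightarrow> 'a"
  assumes U: "bounded_clinear U" and V: "bounded_clinear V"
    and M: "complex_vector.subspace M" "closed M"
    and c: "c > 0" "\<And>x. x \<in> M \<Longrightarrow> c * norm x \<le> norm (U x)"
    and UM: "U ` M = M" and VM: "V ` M \<subseteq> M"
    and e: "e \<ge> 0" "e < c" "\<And>x. x \<in> M \<Longrightarrow> norm (V x) \<le> e * norm x"
  shows "M \<subseteq> (\<lambda>x. U x + V x) ` M"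
proof
  fix y assume y: "y \<in> M"
  define S where "S = inv_into M U"
  have S: "S z \<in> M" "U (S z) = z" if "z \<in> M" for z
    using that UM by (auto simp: S_def inv_into_into f_inv_into_f)
  have yV: "y - V x \<in> M" if "x \<in> M" for x
    using that VM y M(1) by (auto intro: complex_vector.subspace_diff)
  have "\<exists>!x\<in>M. S (y - V x) = x"
  proof (rule Banach_fix)
    show "complete M" using M(2) complete_eq_closed by blast
    show "M \<noteq> {}" using y by blast
    show "0 \<le> e / c" "e / c < 1" using c e by auto
    show "(\<lambda>x. S (y - V x)) ` M \<subseteq> M" using S yV by blast
    fix x x' assume x: "x \<in> M" "x' \<in> M"
    let ?d = "S (y - V x) - S (y - V x')"
    have "?d \<in> M" using S yV x M(1) by (simp add: complex_vector.subspace_diff)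
    then have "c * norm ?d \<le> norm (U ?d)" by (rule c)
    also have "U ?d = V (x' - x)"
      using S yV x by (simp add: bounded_clinear_diff[OF U] bounded_clinear_diff[OF V])
    also have "norm \<dots> \<le> e * norm (x' - x)"
      using e x M(1) by (simp add: complex_vector.subspace_diff)
    finally show "dist (S (y - V x)) (S (y - V x')) \<le> e / c * dist x x'"
      using c(1) by (simp add: dist_norm norm_minus_commute field_simps)
  qed
  then obtain x where "x \<in> M" "S (y - V x) = x" by blast
  then have "U x + V x = y" using S(2)[OF yV] by (metis diff_add_cancel)
  then show "y \<in> (\<lambda>x. U x + V x) ` M" using \<open>x \<in> M\<close> by blast
qed

lemma shift_op_surj_perturb:
  fixes T :: "'a::complex_banach \<Rightarrow> 'a"
  assumes T: "bounded_clinear T" and M: "complex_vector.subspace M" "closed M" "T ` M \<subseteq> M"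
    and c: "\<And>x. x \<in> M \<Longrightarrow> c * norm x \<le> norm (shift_op T l x)"
    and TM: "shift_op T l ` M = M" and m: "cmod (m - l) < c"
  shows "shift_op T m ` M = M"
proof -
  have "M \<subseteq> (\<lambda>x. shift_op T l x + (l - m) *\<^sub>C x) ` M"
  proof (rule surj_perturb[OF bounded_clinear_shift_op[OF T] _ M(1,2) _ c TM])
    show "bounded_clinear (\<lambda>x. (l - m) *\<^sub>C (x::'a))" by (rule bounded_clinear_scaleC_left)
    show "0 < c" by (rule le_less_trans[OF norm_ge_zero m])
    show "(\<lambda>x. (l - m) *\<^sub>C x) ` M \<subseteq> M" using M(1) by (auto intro: complex_vector.subspace_scale)
    show "0 \<le> cmod (m - l)" "cmod (m - l) < c" using m by auto
    show "norm ((l - m) *\<^sub>C x) \<le> cmod (m - l) * norm x" for x :: 'a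
      by (simp add: norm_scaleC norm_minus_commute)
  qed
  also have "(\<lambda>x. shift_op T l x + (l - m) *\<^sub>C x) = shift_op T m"
    by (auto simp: shift_op_def scaleC_diff_left)
  finally show ?thesis using shift_op_image_subset[OF M(3,1)] by blast
qed

lemma shift_op_lower_bound:
  assumes "c * norm x \<le> norm (shift_op T l x)"
  shows "(c - cmod (m - l)) * norm x \<le> norm (shift_op T m x)"
proof -
  have "norm (shift_op T l x) \<le> norm (shift_op T m x) + norm ((m - l) *\<^sub>C x)"
    using norm_triangle_ineq[of "shift_op T m x" "(m - l) *\<^sub>C x"]
    by (simp add: shift_op_def scaleC_diff_left)
  then show ?thesis using assms by (simp only: norm_scaleC) (simp add: algebra_simps)
qed

text \<open>The radius within which surjectivity persists is governed by the lower bound alone. Near a point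
  \<open>l\<close> with lower bound \<open>c\<close> the bound stays above \<open>2 * c / 3\<close> on the ball of radius \<open>c / 3\<close>, while two
  points of that ball differ by less than \<open>2 * c / 3\<close>; so surjectivity at one point of the ball
  gives it at every other. It is therefore locally constant in \<open>l\<close>, hence constant on connected
  sets. This replaces both the index of semi-Fredholm operators and the statement that the boundary
  of the spectrum consists of approximate eigenvalues.\<close>
lemma surj_on_connected:
  fixes T :: "'a::complex_banach \<Rightarrow> 'a"
  assumes T: "bounded_clinear T" and M: "complex_vector.subspace M" "closed M" "T ` M \<subseteq> M"
    and H: "connected H" and bb: "\<And>l. l \<in> H \<Longrightarrow> bounded_below_on M (shift_op T l)"
    and l0: "l0 \<in> H" "shift_op T l0 ` M = M" and l: "l \<in> H"
  shows "shift_op T l ` M = M"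
proof (rule connected_induction_simple[OF H l0(1) l, where P = "\<lambda>l. shift_op T l ` M = M"])
  fix l assume "l \<in> H"
  then obtain c where c: "c > 0" "\<And>x. x \<in> M \<Longrightarrow> c * norm x \<le> norm (shift_op T l x)"
    using bb unfolding bounded_below_on_def by blast
  let ?B = "H \<inter> ball l (c / 3)"
  have "shift_op T m' ` M = M" if "m \<in> ?B" "m' \<in> ?B" "shift_op T m ` M = M" for m m'
  proof (rule shift_op_surj_perturb[OF T M _ that(3), where c = "c - cmod (m - l)"])
    have "cmod (m - l) < c / 3" "cmod (m' - l) < c / 3"
      using that by (auto simp: dist_norm norm_minus_commute)
    moreover have "cmod (m' - m) \<le> cmod (m' - l) + cmod (m - l)"
      using norm_triangle_ineq4[of "m' - l" "m - l"] by simp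
    ultimately show "cmod (m' - m) < c - cmod (m - l)" by linarith
    fix x assume "x \<in> M"
    then show "(c - cmod (m - l)) * norm x \<le> norm (shift_op T m x)"
      using c(2) shift_op_lower_bound by blast
  qed
  moreover have "openin (top_of_set H) ?B" "l \<in> ?B"
    using \<open>l \<in> H\<close> c(1) by (auto simp: openin_open)
  ultimately show "\<exists>W. openin (top_of_set H) W \<and> l \<in> W \<and>
      (\<forall>m\<in>W. \<forall>m'\<in>W. shift_op T m ` M = M \<longrightarrow> shift_op T m' ` M = M)"
    by (intro exI[of _ ?B] conjI ballI impI)
qed (rule l0(2))

lemma shift_op_surj_large:
  fixes T :: "'a::complex_banach \<Rightarrow> 'a"
  assumes T: "bounded_clinear T" and M: "complex_vector.subspace M" "closed M" "T ` M \<subseteq> M"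
    and K: "\<And>x. norm (T x) \<le> K * norm x" "K < cmod l" "K \<ge> 0"
  shows "shift_op T l ` M = M"
proof -
  have "M \<subseteq> (\<lambda>x. (- l) *\<^sub>C x + T x) ` M"
  proof (rule surj_perturb[OF _ T M(1,2), where c = "cmod l" and e = K])
    show "bounded_clinear (\<lambda>x. (- l) *\<^sub>C (x::'a))" by (rule bounded_clinear_scaleC_left)
    have "l \<noteq> 0" using K by auto
    have "x \<in> (\<lambda>x. (- l) *\<^sub>C x) ` M" if "x \<in> M" for x
    proof
      show "x = (- l) *\<^sub>C ((- inverse l) *\<^sub>C x)" 
        using \<open>l \<noteq> 0\<close> by (simp only: scaleC_scaleC) (simp add: scaleC_one)
      show "(- inverse l) *\<^sub>C x \<in> M" using M(1) that by (rule complex_vector.subspace_scale)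
    qed
    moreover have "(\<lambda>x. (- l) *\<^sub>C x) ` M \<subseteq> M"
      using M(1) by (auto simp del: complex_vector.scale_minus_left intro: complex_vector.subspace_scale)
    ultimately show "(\<lambda>x. (- l) *\<^sub>C x) ` M = M" by blast
    show "cmod l * norm x \<le> norm ((- l) *\<^sub>C x)" for x :: 'a
      by (simp only: norm_scaleC) simp
  qed (use K M in auto)
  also have "(\<lambda>x. (- l) *\<^sub>C x + T x) = shift_op T l"
    by (auto simp: shift_op_def)
  finally show ?thesis using shift_op_image_subset[OF M(3,1)] by blast
qed

section \<open>The open mapping theorem on closed subspaces\<close>

text \<open>By the Baire property of \<open>T ` M\<close>, the closure of the image of some ball of \<open>M\<close> contains a
  relative ball; by symmetry and scaling, every \<open>y\<close> is approximated up to \<open>norm y / 2\<close> by the image of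
  a vector of comparable norm, and iterating on the remainder gives an exact preimage.\<close>
lemma open_mapping_on:
  fixes T :: "'a::banach \<Rightarrow> 'b::banach"
  assumes T: "bounded_linear T" and M: "subspace M" "closed M" and cl: "closed (T ` M)"
  obtains K where "K > 0" "\<And>y. y \<in> T ` M \<Longrightarrow> \<exists>x\<in>M. T x = y \<and> norm x \<le> K * norm y"
proof -
  define N where "N = T ` M"
  have lin: "linear T" using T by (rule bounded_linear.linear)
  have N: "subspace N" unfolding N_def using M lin by (simp add: linear_subspace_image)
  define F where "F n = closure (T ` (M \<inter> cball 0 (real n)))" for n
  have FN: "F n \<subseteq> N" for n
    unfolding F_def N_def using cl by (intro closure_minimal) auto
  have "\<exists>n. top_of_set N interior_of F n \<noteq> {}"
  proof (rule ccontr)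
    assume "\<not> ?thesis"
    then have "top_of_set N interior_of (\<Union>n. F n) = {}"
    proof (intro Baire_category_alt disjI1)
      show "completely_metrizable_space (top_of_set N)"
        using cl completely_metrizable_space_closedin completely_metrizable_space_euclidean
        unfolding N_def by (metis closed_closedin)
    qed (use FN in \<open>auto simp: closed_subset F_def\<close>)
    moreover have "(\<Union>n. F n) = N"
    proof
      show "N \<subseteq> (\<Union>n. F n)"
      proof
        fix y assume "y \<in> N"
        then obtain x where x: "x \<in> M" "y = T x" unfolding N_def by blast
        moreover obtain n where "norm x \<le> real n" using real_arch_simple by blast
        ultimately have "y \<in> F n" unfolding F_def by (intro closure_subset[THEN subsetD]) auto
        then show "y \<in> (\<Union>n. F n)" by blast
      qed
    qed (use FN in blast)
    ultimately have "top_of_set N interior_of N = {}" by (simp only:)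
    moreover have "top_of_set N interior_of N = N"
      using interior_of_topspace[of "top_of_set N"] by simp
    ultimately show False using subspace_0[OF N] by blast
  qed
  then obtain n y0 where "y0 \<in> top_of_set N interior_of F n" by blast
  then obtain G where G: "open G" "y0 \<in> N \<inter> G" "N \<inter> G \<subseteq> F n"
    unfolding interior_of_def openin_open by auto
  then obtain r where r: "r > 0" "ball y0 r \<subseteq> G" using open_contains_ball by blast
  \<comment> \<open>A difference of two approximations near \<open>y0\<close> moves the ball from \<open>y0\<close> to the origin.\<close>
  have half: "\<exists>x\<in>M. norm x \<le> 2 * real n \<and> norm (y - T x) < e"
    if y: "y \<in> N" "norm y < r" and "e > 0" for y e
  proof -
    have "y0 + y \<in> N \<inter> G" "y0 \<in> N \<inter> G"
      using G r y N by (auto simp: subspace_add dist_norm)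
    then have "y0 + y \<in> F n" "y0 \<in> F n" using G(3) by blast+
    then obtain a b where a: "a \<in> M" "norm a \<le> n" "dist (T a) (y0 + y) < e / 2"
      and b: "b \<in> M" "norm b \<le> n" "dist (T b) y0 < e / 2"
      using \<open>e > 0\<close> unfolding F_def closure_approachable
      by (force dest!: spec[of _ "e / 2"])
    show ?thesis
    proof (intro bexI conjI)
      show "a - b \<in> M" using a b M by (simp add: subspace_diff)
      show "norm (a - b) \<le> 2 * real n" using a b norm_triangle_ineq4[of a b] by linarith
      have "y - T (a - b) = (T b - y0) - (T a - (y0 + y))" using lin by (simp add: linear_diff)
      then have "norm (y - T (a - b)) \<le> norm (T b - y0) + norm (T a - (y0 + y))"
        by (simp only: norm_triangle_ineq4)
      then show "norm (y - T (a - b)) < e"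
        using a(3) b(3) unfolding dist_norm by linarith
    qed
  qed
  define k where "k = 4 * real n / r"
  have k0: "k \<ge> 0" using r by (simp add: k_def)
  have step: "\<exists>x\<in>M. norm x \<le> k * norm y \<and> norm (y - T x) \<le> norm y / 2" if y: "y \<in> N" for y
  proof (cases "y = 0")
    case True
    then show ?thesis using M lin by (auto intro!: bexI[of _ 0] simp: subspace_0 linear_0)
  next
    case False
    define s where "s = r / (2 * norm y)"
    have s: "s > 0" using False r by (simp add: s_def)
    have "s *\<^sub>R y \<in> N" "norm (s *\<^sub>R y) < r" "r / 4 > 0"
      using y N r False by (simp_all add: subspace_scale s_def)
    then have "\<exists>x\<in>M. norm x \<le> 2 * real n \<and> norm (s *\<^sub>R y - T x) < r / 4" by (rule half)
    then obtain x where x: "x \<in> M" "norm x \<le> 2 * real n" "norm (s *\<^sub>R y - T x) < r / 4"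
      by (elim bexE conjE)
    show ?thesis
    proof (intro bexI conjI)
      show "inverse s *\<^sub>R x \<in> M" using x M by (simp add: subspace_scale)
      have "norm (inverse s *\<^sub>R x) = 2 * norm y / r * norm x" using s r by (simp add: s_def)
      also have "\<dots> \<le> 2 * norm y / r * (2 * n)" using x r by (intro mult_left_mono) auto
      finally show "norm (inverse s *\<^sub>R x) \<le> k * norm y" by (simp add: k_def mult_ac)
      have "y - T (inverse s *\<^sub>R x) = inverse s *\<^sub>R (s *\<^sub>R y - T x)"
        using s lin by (simp add: linear_scale scaleR_diff_right)
      then have "norm (y - T (inverse s *\<^sub>R x)) = inverse s * norm (s *\<^sub>R y - T x)"
        using s by simp
      also have "\<dots> \<le> inverse s * (r / 4)" using x s by (intro mult_left_mono) auto
      finally show "norm (y - T (inverse s *\<^sub>R x)) \<le> norm y / 2"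
        using r by (simp add: s_def field_simps)
    qed
  qed
  then obtain p where p: "\<And>y. y \<in> N \<Longrightarrow> p y \<in> M"
    "\<And>y. y \<in> N \<Longrightarrow> norm (p y) \<le> k * norm y"
    "\<And>y. y \<in> N \<Longrightarrow> norm (y - T (p y)) \<le> norm y / 2"
    by metis
  have "\<exists>x\<in>M. T x = y \<and> norm x \<le> (2 * k + 1) * norm y" if y: "y \<in> N" for y
  proof -
    \<comment> \<open>\<open>z j\<close> is the error that remains after \<open>j\<close> corrections; it is at least halved each time.\<close>
    define z where "z j = ((\<lambda>y. y - T (p y)) ^^ j) y" for j
    have z_Suc: "z (Suc j) = z j - T (p (z j))" for j by (simp add: z_def)
    have zN: "z j \<in> N" for j
    proof (induction j)
      case (Suc j)
      then have "T (p (z j)) \<in> N" using p N_def by blast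
      then show ?case using Suc N by (simp add: z_Suc subspace_diff)
    qed (simp add: z_def y)
    have zb: "norm (z j) \<le> norm y * (1 / 2) ^ j" for j
    proof (induction j)
      case (Suc j)
      then show ?case using p(3)[OF zN[of j]] by (simp add: z_Suc)
    qed (simp add: z_def)
    have xb: "norm (p (z j)) \<le> k * norm y * (1 / 2) ^ j" for j
      using p(2)[OF zN[of j]] mult_left_mono[OF zb[of j] k0] by (simp add: mult.assoc)
    have sb: "summable (\<lambda>j. k * norm y * (1 / 2) ^ j)"
      by (intro summable_mult summable_geometric) auto
    then have sm: "summable (\<lambda>j. p (z j))" using xb by (rule summable_comparison_test')
    define x where "x = (\<Sum>j. p (z j))"
    have lim: "(\<lambda>j. \<Sum>i<j. p (z i)) \<longlonglongrightarrow> x" unfolding x_def using sm by (rule summable_LIMSEQ)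
    have "x \<in> M"
      by (rule closed_sequentially[OF M(2) _ lim]) (use p zN M in \<open>auto intro: subspace_sum\<close>)
    moreover have "T x = y"
    proof -
      have "T (\<Sum>i<j. p (z i)) = y - z j" for j
      proof (induction j)
        case (Suc j)
        then show ?case using lin by (simp add: linear_add z_Suc)
      qed (use lin in \<open>simp add: linear_0 z_def\<close>)
      moreover have "z \<longlonglongrightarrow> 0"
      proof (rule Lim_null_comparison)
        show "\<forall>\<^sub>F j in sequentially. norm (z j) \<le> norm y * (1 / 2) ^ j" using zb by simp
        show "(\<lambda>j. norm y * (1 / 2) ^ j) \<longlonglongrightarrow> 0"
          by (intro tendsto_mult_right_zero LIMSEQ_realpow_zero) auto
      qed
      ultimately have "(\<lambda>j. T (\<Sum>i<j. p (z i))) \<longlonglongrightarrow> y - 0"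
        by (simp only:) (intro tendsto_intros)
      moreover have "(\<lambda>j. T (\<Sum>i<j. p (z i))) \<longlonglongrightarrow> T x"
        using T lim by (rule bounded_linear.tendsto)
      ultimately show ?thesis using LIMSEQ_unique by fastforce
    qed
    moreover have "norm x \<le> (2 * k + 1) * norm y"
    proof -
      have "norm x \<le> (\<Sum>j. norm (p (z j)))" unfolding x_def
        by (rule summable_norm) (rule summable_comparison_test'[OF sb], use xb in simp)
      also have "\<dots> \<le> (\<Sum>j. k * norm y * (1 / 2) ^ j)"
        by (rule suminf_le[OF xb]) (rule summable_comparison_test'[OF sb], use xb sb in auto)
      also have "\<dots> = k * norm y * (\<Sum>j. (1 / 2) ^ j)"
        by (rule suminf_mult) (intro summable_geometric, simp)
      also have "\<dots> = 2 * k * norm y" by (simp add: suminf_geometric)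
      also have "\<dots> \<le> (2 * k + 1) * norm y" by (simp add: distrib_right)
      finally show ?thesis .
    qed
    ultimately show ?thesis by blast
  qed
  moreover have "2 * k + 1 > 0" using k0 by simp
  ultimately show ?thesis using that unfolding N_def by blast
qed

section \<open>Tame operators\<close>

text \<open>A bounded chain is the sequence of Taylor coefficients at \<open>0\<close> of an analytic function \<open>f\<close> with
  \<open>T (f m) = m *\<^sub>C f m\<close>. That all chains of \<open>T - l\<close> start at \<open>0\<close> is thus the single-valued extension
  property of \<open>T\<close> at \<open>l\<close>, phrased so that no analyticity is mentioned.\<close>
definition bounded_chain :: "('a::complex_normed_vector \<Rightarrow> 'a) \<Rightarrow> (nat \<Rightarrow> 'a) \<Rightarrow> bool"
  where "bounded_chain T x \<longleftrightarrow> T (x 0) = 0 \<and> (\<forall>n. T (x (Suc n)) = x n) \<and>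
    (\<exists>D C. \<forall>n. norm (x n) \<le> D * C ^ n)"

text \<open>The second clause says that the spectrum consists of approximate eigenvalues; it is what is needed
  of the single-valued extension property of the adjoint, without speaking of dual spaces.\<close>
definition tame :: "('a::complex_normed_vector \<Rightarrow> 'a) \<Rightarrow> bool"
  where "tame T \<longleftrightarrow> (\<forall>l.
    (\<forall>x. bounded_chain (shift_op T l) x \<longrightarrow> x 0 = 0) \<and>
    (bounded_below_on UNIV (shift_op T l) \<longrightarrow> range (shift_op T l) = UNIV))"

text \<open>The eigenvectors \<open>f m = (\<Sum>n. m ^ n *\<^sub>C x n)\<close> lie in every closed subspace that contains the chain
  and satisfy \<open>norm (f m - x 0) \<le> const * cmod m\<close>. So it suffices that \<open>f m\<close> vanishes at parameters
  \<open>m\<close> arbitrarily close to \<open>0\<close>, with a subspace that may depend on \<open>m\<close>.\<close>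
lemma bounded_chain_start_zero:
  fixes T :: "'a::complex_banach \<Rightarrow> 'a"
  assumes T: "bounded_clinear T" and x: "bounded_chain T x"
    and inj: "\<And>e. e > 0 \<Longrightarrow> \<exists>m Z. cmod m < e \<and> complex_vector.subspace Z \<and> closed Z \<and>
      range x \<subseteq> Z \<and> (\<forall>z\<in>Z. T z = m *\<^sub>C z \<longrightarrow> z = 0)"
  shows "x 0 = 0"
proof (rule ccontr)
  assume "x 0 \<noteq> 0"
  obtain D' C' where DC': "\<And>n. norm (x n) \<le> D' * C' ^ n"
    using x unfolding bounded_chain_def by blast
  define D C where "D = \<bar>D'\<bar>" and "C = \<bar>C'\<bar> + 1"
  have D: "D \<ge> 0" and C: "C > 0" by (auto simp: D_def C_def)
  have xb: "norm (x n) \<le> D * C ^ n" for n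
  proof -
    have "norm (x n) \<le> \<bar>D'\<bar> * \<bar>C'\<bar> ^ n"
      using DC'[of n] abs_ge_self[of "D' * C' ^ n"] by (simp add: abs_mult power_abs)
    also have "\<dots> \<le> D * C ^ n"
      unfolding D_def C_def by (intro mult_left_mono power_mono) auto
    finally show ?thesis .
  qed
  \<comment> \<open>The first bound makes the series converge geometrically; the second makes \<open>f m\<close> so close to \<open>x 0\<close> that it cannot vanish.\<close>
  define e where "e = min (1 / (2 * C)) (norm (x 0) / (2 * D * C + 1))"
  have "0 < 2 * D * C + 1" using D C by (simp add: add_nonneg_pos)
  then have "e > 0" using C \<open>x 0 \<noteq> 0\<close> by (simp add: e_def)
  then obtain m Z where m: "cmod m < e" and Z: "complex_vector.subspace Z" "closed Z" "range x \<subseteq> Z"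
    and Zinj: "\<And>z. z \<in> Z \<Longrightarrow> T z = m *\<^sub>C z \<Longrightarrow> z = 0"
    using inj by metis
  have m1: "cmod m * C \<le> 1 / 2" using m C by (simp add: e_def field_simps)
  have pow: "norm (m ^ n *\<^sub>C x n) \<le> D * (1 / 2) ^ n" for n
  proof -
    have "norm (m ^ n *\<^sub>C x n) \<le> cmod m ^ n * (D * C ^ n)"
      using xb[of n] by (simp add: norm_scaleC norm_power mult_left_mono)
    also have "\<dots> = D * (cmod m * C) ^ n" by (simp add: power_mult_distrib)
    also have "\<dots> \<le> D * (1 / 2) ^ n" using m1 C D by (intro mult_left_mono power_mono) auto
    finally show ?thesis .
  qed
  have pow': "norm (m ^ n *\<^sub>C x (Suc n)) \<le> D * C * (1 / 2) ^ n" for n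
  proof -
    have "norm (m ^ n *\<^sub>C x (Suc n)) \<le> cmod m ^ n * (D * C ^ Suc n)"
      using xb[of "Suc n"] by (simp only: norm_scaleC norm_power) (rule mult_left_mono, auto)
    also have "\<dots> = D * C * (cmod m * C) ^ n" by (simp add: power_mult_distrib)
    also have "\<dots> \<le> D * C * (1 / 2) ^ n" using m1 C D by (intro mult_left_mono power_mono) auto
    finally show ?thesis .
  qed
  have sg: "summable (\<lambda>n. c * (1 / 2 :: real) ^ n)" for c
    by (intro summable_mult summable_geometric) auto
  have sm: "summable (\<lambda>n. m ^ n *\<^sub>C x n)" using sg pow by (rule summable_comparison_test')
  have sm': "summable (\<lambda>n. m ^ n *\<^sub>C x (Suc n))" using sg pow' by (rule summable_comparison_test')
  define f where "f = (\<Sum>n. m ^ n *\<^sub>C x n)"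
  define g where "g = (\<Sum>n. m ^ n *\<^sub>C x (Suc n))"
  have m_suminf: "m *\<^sub>C suminf h = (\<Sum>n. m *\<^sub>C h n)" if "summable h" for h :: "nat \<Rightarrow> 'a"
    using bounded_linear.suminf[OF bounded_clinear_linear[OF bounded_clinear_scaleC_left] that] .
  have f_split: "f = x 0 + m *\<^sub>C g"
  proof -
    have "f = (\<Sum>n. m ^ Suc n *\<^sub>C x (Suc n)) + m ^ 0 *\<^sub>C x 0"
      unfolding f_def using suminf_split_head[OF sm] by simp
    then show ?thesis by (simp add: g_def m_suminf[OF sm'] scaleC_scaleC scaleC_one)
  qed
  have "T f = (\<Sum>n. T (m ^ n *\<^sub>C x n))"
    unfolding f_def using bounded_linear.suminf[OF bounded_clinear_linear[OF T] sm] .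
  also have "\<dots> = (\<Sum>n. T (m ^ Suc n *\<^sub>C x (Suc n))) + T (m ^ 0 *\<^sub>C x 0)"
    using suminf_split_head[OF bounded_linear.summable[OF bounded_clinear_linear[OF T] sm]] by simp
  also have "\<dots> = (\<Sum>n. m *\<^sub>C (m ^ n *\<^sub>C x n))"
    using x by (simp add: bounded_clinear_scaleC[OF T] bounded_chain_def scaleC_scaleC)
  also have "\<dots> = m *\<^sub>C f" by (simp add: f_def m_suminf[OF sm])
  finally have Tf: "T f = m *\<^sub>C f" .
  have "f \<in> Z"
  proof (rule closed_sequentially[OF Z(2)])
    show "(\<lambda>n. \<Sum>i<n. m ^ i *\<^sub>C x i) \<longlonglongrightarrow> f" unfolding f_def using sm by (rule summable_LIMSEQ)
    show "(\<Sum>i<n. m ^ i *\<^sub>C x i) \<in> Z" for n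
      using Z by (intro complex_vector.subspace_sum complex_vector.subspace_scale) auto
  qed
  then have "f = 0" using Tf Zinj by blast
  then have "norm (x 0) = cmod m * norm g"
    using f_split by (metis add_eq_0_iff norm_minus_cancel norm_scaleC)
  moreover have "norm g \<le> 2 * D * C"
  proof -
    have "norm g \<le> (\<Sum>n. norm (m ^ n *\<^sub>C x (Suc n)))" unfolding g_def
      by (rule summable_norm) (rule summable_comparison_test'[OF sg], use pow' in simp)
    also have "\<dots> \<le> (\<Sum>n. D * C * (1 / 2) ^ n)"
      by (rule suminf_le[OF pow']) (rule summable_comparison_test'[OF sg], use pow' sg in auto)
    also have "\<dots> = D * C * (\<Sum>n. (1 / 2) ^ n)"
      by (rule suminf_mult) (intro summable_geometric, simp)
    also have "\<dots> = 2 * D * C" by (simp add: suminf_geometric)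
    finally show ?thesis .
  qed
  ultimately have "norm (x 0) \<le> cmod m * (2 * D * C)" by (simp add: mult_left_mono)
  also have "\<dots> \<le> cmod m * (2 * D * C + 1)" by (simp add: mult_left_mono)
  also have "\<dots> < e * (2 * D * C + 1)" using m \<open>0 < 2 * D * C + 1\<close> by (rule mult_strict_right_mono)
  also have "\<dots> \<le> norm (x 0) / (2 * D * C + 1) * (2 * D * C + 1)"
    using \<open>0 < 2 * D * C + 1\<close> by (intro mult_right_mono) (auto simp: e_def)
  also have "\<dots> = norm (x 0)" using \<open>0 < 2 * D * C + 1\<close> by simp
  finally show False by simp
qed

lemma closed_invariant_subspaceD:
  assumes "closed_invariant_subspace T M"
  shows "complex_vector.subspace M" "closed M" "T ` M \<subseteq> M"
  using assms by (auto simp: closed_invariant_subspace_def)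

lemma not_in_spectrum_on:
  assumes T: "bounded_clinear T" and M: "closed_invariant_subspace T M" and l: "l \<notin> spectrum_on M T"
  shows "bounded_below_on M (shift_op T l)" "shift_op T l ` M = M"
  using l invertible_on_iff[OF bounded_clinear_shift_op[OF T], of M l]
    shift_op_image_subset[of T M l] closed_invariant_subspaceD[OF M]
  by (auto simp: spectrum_on_def)

text \<open>The covering consists of two overlapping half planes: \<open>l\<close> lies in the first one only, and
  \<open>l + e / 2\<close> in the second one only. Since \<open>T - l\<close> is invertible on \<open>Z2\<close>, and also on \<open>Z1 \<inter> Z2\<close> by
  connecting \<open>l\<close> with infinity inside a half plane that misses the spectrum on \<open>Z2\<close>, a vector is in
  \<open>Z1\<close> as soon as its image under \<open>T - l\<close> is. Hence the whole chain lies in \<open>Z1\<close>, where \<open>l + e / 2\<close>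
  is no eigenvalue.\<close>
lemma decomposable_chain:
  fixes T :: "'a::complex_banach \<Rightarrow> 'a"
  assumes T: "bounded_clinear T" and dec: "decomposable_op T"
    and x: "bounded_chain (shift_op T l) x"
  shows "x 0 = 0"
proof (rule bounded_chain_start_zero[OF bounded_clinear_shift_op[OF T] x])
  fix e :: real assume e: "e > 0"
  define U1 where "U1 = {z. Re z < Re l + e / 3}"
  define U2 where "U2 = {z. Re z > Re l + e / 6}"
  have "open U1" "open U2"
    unfolding U1_def U2_def by (intro open_Collect_less continuous_intros)+
  moreover have "U1 \<union> U2 = UNIV" using e by (auto simp: U1_def U2_def)
  ultimately obtain Z1 Z2 where Z1: "closed_invariant_subspace T Z1" and Z2: "closed_invariant_subspace T Z2"
    and sum: "{x + y | x y. x \<in> Z1 \<and> y \<in> Z2} = UNIV"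
    and sp: "spectrum_on Z1 T \<subseteq> U1" "spectrum_on Z2 T \<subseteq> U2"
    using dec unfolding decomposable_op_def by meson
  note Z1' = closed_invariant_subspaceD[OF Z1] and Z2' = closed_invariant_subspaceD[OF Z2]
  define W where "W = Z1 \<inter> Z2"
  have W: "complex_vector.subspace W" "closed W" "T ` W \<subseteq> W"
    using Z1' Z2' by (auto simp: W_def complex_vector.subspace_inter)
  define H where "H = {z. Re z \<le> Re l + e / 6}"
  have bbZ2: "bounded_below_on Z2 (shift_op T z)" if "z \<in> H" for z
    using not_in_spectrum_on(1)[OF T Z2, of z] sp(2) that by (force simp: H_def U2_def)
  obtain K where K: "K > 0" "\<And>x. norm (T x) \<le> K * norm x" using bounded_clinear_bound[OF T] by blast
  \<comment> \<open>A point of the half plane whose modulus exceeds the norm of \<open>T\<close>.\<close>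
  let ?l0 = "complex_of_real (- K - \<bar>Re l\<bar> - 1)"
  have surjW: "shift_op T l ` W = W"
  proof (rule surj_on_connected[OF T W, where ?l0.0 = ?l0])
    show "connected H" unfolding H_def
      by (intro convex_connected convex_halfspace_Re_le)
    show "l \<in> H" using e by (simp add: H_def)
    show "bounded_below_on W (shift_op T z)" if "z \<in> H" for z
      using bbZ2[OF that] by (rule bounded_below_on_subset) (simp add: W_def)
    show "?l0 \<in> H" using e K by (auto simp: H_def)
    have "K < cmod ?l0" using K by (simp only: norm_of_real)
    then show "shift_op T ?l0 ` W = W" using shift_op_surj_large[OF T W K(2)] K(1) by simp
  qed
  have pull: "u \<in> Z1" if u: "shift_op T l u \<in> Z1" for u
  proof -
    obtain z1 z2 where z: "u = z1 + z2" "z1 \<in> Z1" "z2 \<in> Z2" using sum by blast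
    have "shift_op T l z2 = shift_op T l u - shift_op T l z1"
      by (simp add: z(1) bounded_clinear_add[OF bounded_clinear_shift_op[OF T]])
    also have "\<dots> \<in> Z1"
      using u z shift_op_image_subset[OF Z1'(3,1)] Z1'(1) by (blast intro: complex_vector.subspace_diff)
    finally have "shift_op T l z2 \<in> W"
      using z shift_op_image_subset[OF Z2'(3,1)] by (auto simp: W_def)
    then obtain w where w: "w \<in> W" "shift_op T l w = shift_op T l z2" using surjW by (metis imageE)
    have "z2 - w = 0"
    proof (rule bounded_below_on_kernel)
      show "bounded_below_on Z2 (shift_op T l)" using bbZ2 e by (simp add: H_def)
      show "z2 - w \<in> Z2" using w z Z2' by (auto simp: W_def complex_vector.subspace_diff)
      show "shift_op T l (z2 - w) = 0"
        using w by (simp add: bounded_clinear_diff[OF bounded_clinear_shift_op[OF T]])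
    qed
    then show ?thesis using w z Z1' by (auto simp: W_def complex_vector.subspace_add)
  qed
  have "x n \<in> Z1" for n
  proof (induction n)
    case 0
    have "shift_op T l (x 0) = 0" using x by (simp add: bounded_chain_def)
    then show ?case using pull[of "x 0"] complex_vector.subspace_0[OF Z1'(1)] by simp
  next
    case (Suc n)
    have "shift_op T l (x (Suc n)) = x n" using x by (simp add: bounded_chain_def)
    then show ?case using pull[of "x (Suc n)"] Suc by simp
  qed
  moreover have "z = 0" if z: "z \<in> Z1" "shift_op T l z = complex_of_real (e / 2) *\<^sub>C z" for z
  proof (rule bounded_below_on_kernel[OF _ z(1)])
    have "l + complex_of_real (e / 2) \<notin> U1" using e by (simp add: U1_def)
    then show "bounded_below_on Z1 (shift_op T (l + complex_of_real (e / 2)))"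
      using not_in_spectrum_on[OF T Z1] sp by blast
    show "shift_op T (l + complex_of_real (e / 2)) z = 0"
      using z(2) by (simp add: shift_op_shift_op[symmetric] shift_op_apply)
  qed
  ultimately show "\<exists>m Z. cmod m < e \<and> complex_vector.subspace Z \<and> closed Z \<and>
      range x \<subseteq> Z \<and> (\<forall>z\<in>Z. shift_op T l z = m *\<^sub>C z \<longrightarrow> z = 0)"
    using Z1' e by (intro exI[of _ "complex_of_real (e / 2)"] exI[of _ Z1]) auto
qed

text \<open>With a lower bound \<open>c\<close> at \<open>l\<close>, cover the plane by the disc of radius \<open>c\<close> around \<open>l\<close> and the complement
  of the closed disc of radius \<open>c / 2\<close>. On \<open>Z2\<close> the operator \<open>T - l\<close> is invertible. On \<open>Z1\<close> all
  points outside the disc are regular and all points inside have a lower bound, so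
  connectedness of the plane makes \<open>l\<close> regular too.\<close>
lemma decomposable_surj:
  fixes T :: "'a::complex_banach \<Rightarrow> 'a"
  assumes T: "bounded_clinear T" and dec: "decomposable_op T"
    and bb: "bounded_below_on UNIV (shift_op T l)"
  shows "range (shift_op T l) = UNIV"
proof -
  obtain c where c: "c > 0" "\<And>x. c * norm x \<le> norm (shift_op T l x)"
    using bb unfolding bounded_below_on_def by blast
  define U2 where "U2 = {z. cmod (z - l) > c / 2}"
  have "open (ball l c)" "open U2"
    unfolding U2_def by (auto intro!: open_Collect_less continuous_intros)
  moreover have "ball l c \<union> U2 = UNIV" using c by (auto simp: U2_def dist_norm norm_minus_commute)
  ultimately obtain Z1 Z2 where Z1: "closed_invariant_subspace T Z1" and Z2: "closed_invariant_subspace T Z2"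
    and sum: "{x + y | x y. x \<in> Z1 \<and> y \<in> Z2} = UNIV"
    and sp: "spectrum_on Z1 T \<subseteq> ball l c" "spectrum_on Z2 T \<subseteq> U2"
    using dec unfolding decomposable_op_def by meson
  have "l \<notin> U2" using c by (simp add: U2_def)
  then have Z2surj: "shift_op T l ` Z2 = Z2" using not_in_spectrum_on[OF T Z2] sp by blast
  have far: "z \<notin> spectrum_on Z1 T" if "z \<notin> ball l c" for z using sp that by blast
  have Z1surj: "shift_op T l ` Z1 = Z1"
  proof (rule surj_on_connected[OF T closed_invariant_subspaceD[OF Z1]])
    show "connected (UNIV :: complex set)" by (rule connected_UNIV)
    show "bounded_below_on Z1 (shift_op T z)" for z
    proof (cases "z \<in> ball l c")
      case True
      show ?thesis
      proof (rule bounded_below_onI)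
        show "0 < c - cmod (z - l)" using True by (simp add: dist_norm norm_minus_commute)
      qed (use c shift_op_lower_bound in blast)
    qed (use far not_in_spectrum_on[OF T Z1] in blast)
    show "shift_op T (l + of_real c) ` Z1 = Z1"
      using far[of "l + of_real c"] not_in_spectrum_on[OF T Z1] c by (simp add: dist_norm)
  qed simp_all
  have "y \<in> range (shift_op T l)" for y
  proof -
    obtain z1 z2 where "y = z1 + z2" "z1 \<in> Z1" "z2 \<in> Z2" using sum by blast
    then obtain u1 u2 where "y = shift_op T l u1 + shift_op T l u2"
      using Z1surj Z2surj by (metis imageE)
    then have "y = shift_op T l (u1 + u2)"
      by (simp add: bounded_clinear_add[OF bounded_clinear_shift_op[OF T]])
    then show ?thesis by blast
  qed
  then show ?thesis by blast
qed

lemma decomposable_tame: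
  fixes T :: "'a::complex_banach \<Rightarrow> 'a"
  assumes "bounded_clinear T" "decomposable_op T"
  shows "tame T"
  using decomposable_chain[OF assms] decomposable_surj[OF assms] by (auto simp: tame_def)

text \<open>The eigenvectors generated by a chain would have to live on a whole disc of parameters, which is
  uncountable; and the complement of a countable set is connected and reaches the region
  \<open>cmod l0 > K\<close>, where \<open>T - l0\<close> is invertible.\<close>
lemma countable_approximate_point_spectrum_tame:
  fixes T :: "'a::complex_banach \<Rightarrow> 'a"
  assumes T: "bounded_clinear T" and E: "countable E"
    and bb: "\<And>l. l \<notin> E \<Longrightarrow> bounded_below_on UNIV (shift_op T l)"
  shows "tame T"
  unfolding tame_def
proof (intro allI conjI impI)
  fix l x assume x: "bounded_chain (shift_op T l) x"
  show "x 0 = 0"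
  proof (rule bounded_chain_start_zero[OF bounded_clinear_shift_op[OF T] x])
    fix e :: real assume "e > 0"
    then have "\<not> ball l e \<subseteq> E" using E uncountable_ball countable_subset by blast
    then obtain k where k: "k \<in> ball l e" "k \<notin> E" by blast
    have "z = 0" if "shift_op T l z = (k - l) *\<^sub>C z" for z
    proof (rule bounded_below_on_kernel[OF bb[OF k(2)] UNIV_I])
      show "shift_op T k z = 0" using that by (simp add: shift_op_def scaleC_diff_left)
    qed
    then show "\<exists>m Z. cmod m < e \<and> complex_vector.subspace Z \<and> closed Z \<and>
        range x \<subseteq> Z \<and> (\<forall>z\<in>Z. shift_op T l z = m *\<^sub>C z \<longrightarrow> z = 0)"
      using k(1) by (intro exI[of _ "k - l"] exI[of _ UNIV]) (auto simp: dist_norm norm_minus_commute)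
  qed
next
  fix l assume bbl: "bounded_below_on UNIV (shift_op T l)"
  obtain K where K: "K > 0" "\<And>x. norm (T x) \<le> K * norm x" using bounded_clinear_bound[OF T] by blast
  have "\<not> ball (of_real (K + 1)) 1 \<subseteq> E"
    using E uncountable_ball countable_subset by (metis zero_less_one)
  then obtain l0 where l0: "l0 \<in> ball (of_real (K + 1)) 1" "l0 \<notin> E" by blast
  have "norm (complex_of_real (K + 1)) - norm l0 < 1"
    using l0(1) norm_triangle_ineq2[of "complex_of_real (K + 1)" l0]
    by (simp only: mem_ball dist_norm)
  then have "K < cmod l0" using K(1) by (simp only: norm_of_real)
  show "range (shift_op T l) = UNIV"
  proof (rule surj_on_connected[OF T])
    show "connected (- (E - {l}))"
      using E by (intro path_connected_imp_connected path_connected_complement_countable) auto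
    show "shift_op T l0 ` UNIV = UNIV"
      using shift_op_surj_large[OF T _ _ _ K(2)] K(1) \<open>K < cmod l0\<close> by simp
  qed (use bb bbl l0 in auto)
qed

section \<open>Algebraic and compact operators are tame\<close>

text \<open>An approximate eigenvector of \<open>T\<close> for \<open>l\<close> is one of \<open>T ^^ i\<close> for \<open>l ^ i\<close>; by linearity, an
  approximate eigenvector then makes \<open>poly p l *\<^sub>C x\<close> close to \<open>p(T) x\<close>.\<close>
lemma funpow_eigen_estimate:
  assumes T: "bounded_clinear T"
  shows "\<exists>K\<ge>0. \<forall>x. norm ((T ^^ i) x - l ^ i *\<^sub>C x) \<le> K * norm (shift_op T l x)"
proof (induction i)
  case 0
  show ?case by (intro exI[of _ 0]) (simp add: scaleC_one)
next
  case (Suc i)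
  then obtain K where K: "K \<ge> 0" "\<And>x. norm ((T ^^ i) x - l ^ i *\<^sub>C x) \<le> K * norm (shift_op T l x)"
    by blast
  obtain L where L: "L > 0" "\<And>x. norm (T x) \<le> L * norm x" using bounded_clinear_bound[OF T] by blast
  show ?case
  proof (intro exI conjI allI)
    show "0 \<le> L * K + cmod l ^ i" using K L by simp
    fix x
    have "(T ^^ Suc i) x - l ^ Suc i *\<^sub>C x = T ((T ^^ i) x - l ^ i *\<^sub>C x) + l ^ i *\<^sub>C shift_op T l x"
      by (simp add: bounded_clinear_diff[OF T] bounded_clinear_scaleC[OF T] shift_op_def
          scaleC_diff_right scaleC_scaleC mult.commute)
    also have "norm \<dots> \<le> norm (T ((T ^^ i) x - l ^ i *\<^sub>C x)) + cmod l ^ i * norm (shift_op T l x)"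
      by (rule order_trans[OF norm_triangle_ineq]) (simp add: norm_scaleC norm_power)
    also have "\<dots> \<le> L * (K * norm (shift_op T l x)) + cmod l ^ i * norm (shift_op T l x)"
      using L(2)[of "(T ^^ i) x - l ^ i *\<^sub>C x"] mult_left_mono[OF K(2)[of x], of L] L(1) by linarith
    finally show "norm ((T ^^ Suc i) x - l ^ Suc i *\<^sub>C x) \<le> (L * K + cmod l ^ i) * norm (shift_op T l x)"
      by (simp add: algebra_simps)
  qed
qed

lemma algebraic_tame:
  fixes T :: "'a::complex_banach \<Rightarrow> 'a"
  assumes T: "bounded_clinear T" and alg: "algebraic_op T"
  shows "tame T"
proof -
  obtain p where p: "p \<noteq> 0" "poly_op p T = (\<lambda>x. 0)" using alg unfolding algebraic_op_def by blast
  show ?thesis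
  proof (rule countable_approximate_point_spectrum_tame[OF T])
    show "countable {l. poly p l = 0}" using p(1) by (simp add: countable_finite poly_roots_finite)
    fix l assume l: "l \<notin> {l. poly p l = 0}"
    have "\<forall>i. \<exists>K\<ge>0. \<forall>x. norm ((T ^^ i) x - l ^ i *\<^sub>C x) \<le> K * norm (shift_op T l x)"
      using funpow_eigen_estimate[OF T] by blast
    then obtain K where K: "\<And>i. K i \<ge> 0"
      "\<And>i x. norm ((T ^^ i) x - l ^ i *\<^sub>C x) \<le> K i * norm (shift_op T l x)"
      by metis
    define L where "L = (\<Sum>i\<le>degree p. cmod (coeff p i) * K i)"
    have L0: "L \<ge> 0" using K by (auto simp: L_def intro!: sum_nonneg)
    have est: "cmod (poly p l) * norm x \<le> L * norm (shift_op T l x)" for x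
    proof -
      have "poly p l *\<^sub>C x = poly p l *\<^sub>C x - poly_op p T x" by (simp add: p(2))
      also have "\<dots> = - (\<Sum>i\<le>degree p. coeff p i *\<^sub>C ((T ^^ i) x - l ^ i *\<^sub>C x))"
        by (simp add: poly_altdef poly_op_def complex_vector.scale_sum_left scaleC_diff_right
            sum_subtractf scaleC_scaleC)
      finally have "norm (poly p l *\<^sub>C x)
          = norm (\<Sum>i\<le>degree p. coeff p i *\<^sub>C ((T ^^ i) x - l ^ i *\<^sub>C x))"
        by (simp only: norm_minus_cancel)
      then have "cmod (poly p l) * norm x
          = norm (\<Sum>i\<le>degree p. coeff p i *\<^sub>C ((T ^^ i) x - l ^ i *\<^sub>C x))"
        by (simp only: norm_scaleC)
      also have "\<dots> \<le> (\<Sum>i\<le>degree p. cmod (coeff p i) * K i * norm (shift_op T l x))"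
        by (intro sum_norm_le) (simp add: norm_scaleC mult.assoc mult_left_mono K(2))
      also have "\<dots> = L * norm (shift_op T l x)" by (simp add: L_def sum_distrib_right)
      finally show ?thesis .
    qed
    show "bounded_below_on UNIV (shift_op T l)"
    proof (rule bounded_below_onI)
      show "0 < cmod (poly p l) / (L + 1)" using l L0 by simp
      fix x :: 'a
      have "cmod (poly p l) * norm x \<le> (L + 1) * norm (shift_op T l x)"
        by (rule order_trans[OF est]) (simp add: algebra_simps)
      then show "cmod (poly p l) / (L + 1) * norm x \<le> norm (shift_op T l x)"
        using L0 by (simp add: field_simps)
    qed
  qed
qed

lemma riesz_almost_orthogonal:
  fixes W V :: "'a::real_normed_vector set"
  assumes W: "subspace W" "closed W" and V: "subspace V" "W \<subseteq> V" and e: "e \<in> V" "e \<notin> W"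
  shows "\<exists>y\<in>V. norm y = 1 \<and> (\<forall>w\<in>W. 1 / 2 \<le> norm (y - w))"
proof -
  have W0: "0 \<in> W" using W subspace_0 by blast
  then have d: "infdist e W > 0" using W e by (metis empty_iff in_closed_iff_infdist_zero infdist_nonneg less_le)
  obtain w0 where w0: "w0 \<in> W" "dist e w0 < 2 * infdist e W"
  proof -
    have "W \<noteq> {}" using W0 by blast
    moreover have "infdist e W < 2 * infdist e W" using d by simp
    ultimately have "(INF a\<in>W. dist e a) < 2 * infdist e W"
      using infdist_notempty[of W e] by simp
    then show ?thesis using that \<open>W \<noteq> {}\<close> by (subst (asm) cINF_less_iff) auto
  qed
  let ?n = "norm (e - w0)"
  have n: "?n > 0" using e w0 by auto
  show ?thesis
  proof (intro bexI conjI ballI)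
    show "(1 / ?n) *\<^sub>R (e - w0) \<in> V" using V W e w0 by (auto intro: subspace_scale subspace_diff)
    show "norm ((1 / ?n) *\<^sub>R (e - w0)) = 1" using n by simp
    fix w assume w: "w \<in> W"
    have "w0 + ?n *\<^sub>R w \<in> W" using W w w0 by (simp add: subspace_add subspace_scale)
    then have "infdist e W \<le> dist e (w0 + ?n *\<^sub>R w)" by (rule infdist_le)
    also have "e - (w0 + ?n *\<^sub>R w) = ?n *\<^sub>R ((1 / ?n) *\<^sub>R (e - w0) - w)"
      using n by (simp add: scaleR_diff_right)
    then have "dist e (w0 + ?n *\<^sub>R w) = ?n * norm ((1 / ?n) *\<^sub>R (e - w0) - w)"
      by (simp add: dist_norm)
    finally have *: "infdist e W \<le> ?n * norm ((1 / ?n) *\<^sub>R (e - w0) - w)" .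
    have "?n < 2 * infdist e W" using w0 by (simp add: dist_norm)
    with * have "?n * (1 / 2) \<le> ?n * norm ((1 / ?n) *\<^sub>R (e - w0) - w)" by linarith
    then show "1 / 2 \<le> norm ((1 / ?n) *\<^sub>R (e - w0) - w)" using n mult_le_cancel_left_pos by blast
  qed
qed

definition eigenvalues :: "('a::complex_normed_vector \<Rightarrow> 'a) \<Rightarrow> complex set"
  where "eigenvalues T = {l. \<exists>e. e \<noteq> 0 \<and> T e = l *\<^sub>C e}"

lemma complex_subspace_imp_real:
  "complex_vector.subspace M \<Longrightarrow> subspace (M :: 'a::complex_normed_vector set)"
  by (auto simp: complex_vector.subspace_def subspace_def simp flip: scaleC_of_real)

lemma compact_op_no_separated_sequence:
  assumes T: "compact_op T" and d: "d > 0" and y: "\<And>n::nat. norm (y n) \<le> 1"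
  shows "\<exists>m n. m < n \<and> norm (T (y n) - T (y m)) < d"
proof -
  have "bounded (range y)" using y by (auto simp: bounded_iff)
  then have "compact (closure (T ` range y))" using T unfolding compact_op_def by blast
  then obtain f r where "strict_mono r" and r: "((\<lambda>n. T (y n)) \<circ> r) \<longlonglongrightarrow> f"
    unfolding compact_def using closure_subset by (metis image_subset_iff rangeI)
  then have "Cauchy ((\<lambda>n. T (y n)) \<circ> r)" using convergent_Cauchy convergent_def by blast
  then obtain N where "\<forall>m\<ge>N. \<forall>n\<ge>N. dist (T (y (r m))) (T (y (r n))) < d"
    using d unfolding Cauchy_def by auto
  then have "norm (T (y (r (Suc N))) - T (y (r N))) < d" by (simp add: dist_norm)
  moreover have "r N < r (Suc N)" using \<open>strict_mono r\<close> by (simp add: strict_mono_def)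
  ultimately show ?thesis by blast
qed

text \<open>Infinitely many eigenvalues \<open>l 0, l 1, \<dots>\<close> of modulus at least \<open>d\<close> give a strictly increasing chain of
  closed invariant subspaces \<open>W n\<close> with \<open>(T - l n) (W (n + 1)) \<subseteq> W n\<close>; almost orthogonal unit vectors
  \<open>y n \<in> W (n + 1)\<close> then have images \<open>T (y n)\<close> at mutual distance at least \<open>d / 2\<close>. Taking for \<open>W n\<close>
  the kernel of \<open>(T - l 0) \<dots> (T - l (n - 1))\<close> instead of the span of the first \<open>n\<close> eigenvectors
  makes its closedness immediate.\<close>
lemma compact_op_finite_eigenvalues:
  fixes T :: "'a::complex_normed_vector \<Rightarrow> 'a"
  assumes T: "bounded_clinear T" and com: "compact_op T" and d: "d > 0"
  shows "finite {l \<in> eigenvalues T. d \<le> cmod l}"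
proof (rule ccontr)
  assume "infinite {l \<in> eigenvalues T. d \<le> cmod l}"
  then obtain l :: "nat \<Rightarrow> complex" where l: "inj l" "range l \<subseteq> {l \<in> eigenvalues T. d \<le> cmod l}"
    using infinite_countable_subset by blast
  then have "\<forall>n. \<exists>e. e \<noteq> 0 \<and> T e = l n *\<^sub>C e" by (auto simp: eigenvalues_def)
  then obtain e where e: "\<And>n. e n \<noteq> 0" "\<And>n. T (e n) = l n *\<^sub>C e n" by metis
  define Q where "Q n = rec_nat (\<lambda>x. x) (\<lambda>i q x. q (shift_op T (l i) x)) n" for n
  have Q0: "Q 0 x = x" and QS: "Q (Suc n) x = Q n (shift_op T (l n) x)" for n x
    by (simp_all add: Q_def)
  have Qlin: "bounded_clinear (Q n)" for n
  proof (induction n)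
    case 0
    show ?case by (simp add: Q_def bounded_clinear_def bounded_linear_ident)
  next
    case (Suc n)
    then show ?case using bounded_clinear_shift_op[OF T, of "l n"]
      by (auto simp: bounded_clinear_def QS intro: bounded_linear_compose)
  qed
  have Qcomm: "Q n (shift_op T k x) = shift_op T k (Q n x)" for n k x
  proof (induction n arbitrary: x)
    case (Suc n)
    have "shift_op T (l n) (shift_op T k x) = shift_op T k (shift_op T (l n) x)"
      by (simp add: shift_op_def bounded_clinear_diff[OF T] bounded_clinear_scaleC[OF T]
          scaleC_diff_right scaleC_scaleC mult.commute)
    then show ?case using Suc by (simp add: QS)
  qed (simp add: Q0)
  have Qe: "Q n (e m) = (\<Prod>i<n. l m - l i) *\<^sub>C e m" for n m
  proof (induction n)
    case (Suc n)
    have "Q (Suc n) (e m) = Q n ((l m - l n) *\<^sub>C e m)" by (simp add: QS shift_op_def e scaleC_diff_left)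
    then show ?case using Suc by (simp add: bounded_clinear_scaleC[OF Qlin] scaleC_scaleC mult.commute)
  qed (simp add: Q0 scaleC_one)
  define W where "W n = {x. Q n x = 0}" for n
  have Wsub: "complex_vector.subspace (W n)" for n
    by (auto simp: W_def complex_vector.subspace_def bounded_clinear_zero[OF Qlin]
        bounded_clinear_add[OF Qlin] bounded_clinear_scaleC[OF Qlin])
  have Wcl: "closed (W n)" for n
    unfolding W_def using bounded_clinear_continuous_on[OF Qlin] by (intro closed_Collect_eq) auto
  have Wshift: "shift_op T k x \<in> W n" if "x \<in> W n" for k x n
    using that bounded_clinear_zero[OF bounded_clinear_shift_op[OF T]] by (simp add: W_def Qcomm)
  have Wstep: "shift_op T (l n) x \<in> W n" if "x \<in> W (Suc n)" for x n
    using that by (simp add: W_def QS)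
  have Wmono: "W m \<subseteq> W n" if "m \<le> n" for m n
    using that
  proof (induction rule: dec_induct)
    case (step n)
    then show ?case using Wshift[of _ n "l n"] by (auto simp: W_def QS)
  qed simp
  have "\<exists>y\<in>W (Suc n). norm y = 1 \<and> (\<forall>w\<in>W n. 1 / 2 \<le> norm (y - w))" for n
  proof (rule riesz_almost_orthogonal)
    show "e n \<in> W (Suc n)" by (simp add: W_def Qe)
    show "e n \<notin> W n" using l(1) e(1) by (auto simp: W_def Qe inj_eq)
  qed (auto intro: complex_subspace_imp_real Wsub Wcl subsetD[OF Wmono[OF le_SucI[OF order_refl]]])
  then obtain y where y: "\<And>n. y n \<in> W (Suc n)" "\<And>n. norm (y n) = 1"
    "\<And>n w. w \<in> W n \<Longrightarrow> 1 / 2 \<le> norm (y n - w)"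
    by metis
  obtain m n where mn: "m < n" "norm (T (y n) - T (y m)) < d / 2"
    using compact_op_no_separated_sequence[OF com, of "d / 2" y] d y(2) by auto
  have ln: "d \<le> cmod (l n)" using l(2) by blast
  then have "l n \<noteq> 0" using d by auto
  define w where "w = T (y m) - shift_op T (l n) (y n)"
  have "T (y m) \<in> W n"
    using Wshift[OF y(1), of 0 m] Wmono[of "Suc m" n] mn(1) by (auto simp: shift_op_zero)
  then have "w \<in> W n"
    unfolding w_def using Wstep[OF y(1)] Wsub by (simp add: complex_vector.subspace_diff)
  then have "inverse (l n) *\<^sub>C w \<in> W n" using Wsub by (simp add: complex_vector.subspace_scale)
  then have "1 / 2 \<le> norm (y n - inverse (l n) *\<^sub>C w)" by (rule y)
  then have "d * (1 / 2) \<le> cmod (l n) * norm (y n - inverse (l n) *\<^sub>C w)"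
    using ln d by (intro mult_mono) auto
  also have "\<dots> = norm (l n *\<^sub>C (y n - inverse (l n) *\<^sub>C w))" by (simp add: norm_scaleC)
  also have "l n *\<^sub>C (y n - inverse (l n) *\<^sub>C w) = T (y n) - T (y m)"
    using \<open>l n \<noteq> 0\<close> by (simp add: scaleC_diff_right scaleC_scaleC scaleC_one w_def shift_op_def)
  finally show False using mn by simp
qed

text \<open>Along a subsequence the images of approximate eigenvectors \<open>x n\<close> converge; as they differ from
  \<open>l *\<^sub>C x n\<close> by a null sequence and \<open>l \<noteq> 0\<close>, the vectors \<open>x n\<close> converge as well, to an
  eigenvector.\<close>
lemma compact_op_bounded_below:
  fixes T :: "'a::complex_normed_vector \<Rightarrow> 'a"
  assumes T: "bounded_clinear T" and com: "compact_op T" and l: "l \<noteq> 0" "l \<notin> eigenvalues T"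
  shows "bounded_below_on UNIV (shift_op T l)"
proof (rule ccontr)
  assume nbb: "\<not> bounded_below_on UNIV (shift_op T l)"
  have "\<exists>x. norm x = 1 \<and> norm (shift_op T l x) < 1 / real (Suc n)" for n
  proof -
    obtain x where x: "norm (shift_op T l x) < 1 / real (Suc n) * norm x"
      using nbb unfolding bounded_below_on_def by (metis UNIV_I not_le of_nat_0_less_iff zero_less_Suc zero_less_divide_1_iff)
    then have "x \<noteq> 0" by auto
    have "shift_op T l ((1 / norm x) *\<^sub>R x) = (1 / norm x) *\<^sub>R shift_op T l x"
      using bounded_clinear_linear[OF bounded_clinear_shift_op[OF T]]
      by (simp add: bounded_linear.linear linear_scale)
    then show ?thesis using x \<open>x \<noteq> 0\<close>
      by (intro exI[of _ "(1 / norm x) *\<^sub>R x"]) (simp add: field_simps)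
  qed
  then obtain x where x: "\<And>n. norm (x n) = 1" "\<And>n. norm (shift_op T l (x n)) < 1 / real (Suc n)"
    by metis
  have "bounded (range x)" using x(1) by (auto simp: bounded_iff)
  then have "compact (closure (T ` range x))" using com unfolding compact_op_def by blast
  then obtain y r where r: "strict_mono r" and y: "((\<lambda>n. T (x n)) \<circ> r) \<longlonglongrightarrow> y"
    unfolding compact_def using closure_subset by (metis image_subset_iff rangeI)
  have "(\<lambda>n. shift_op T l (x n)) \<longlonglongrightarrow> 0"
  proof (rule Lim_null_comparison)
    show "\<forall>\<^sub>F n in sequentially. norm (shift_op T l (x n)) \<le> 1 / real (Suc n)"
      using x(2) less_imp_le by (intro always_eventually) blast
    show "(\<lambda>n. 1 / real (Suc n)) \<longlonglongrightarrow> 0" by (rule lim_1_over_n[THEN LIMSEQ_Suc])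
  qed
  then have "((\<lambda>n. shift_op T l (x n)) \<circ> r) \<longlonglongrightarrow> 0" using r by (rule LIMSEQ_subseq_LIMSEQ)
  then have "(\<lambda>n. inverse l *\<^sub>C (T (x (r n)) - shift_op T l (x (r n)))) \<longlonglongrightarrow> inverse l *\<^sub>C (y - 0)"
    using y unfolding o_def
    by (intro bounded_linear.tendsto[OF bounded_clinear_linear[OF bounded_clinear_scaleC_left]]
        tendsto_diff)
  moreover have "inverse l *\<^sub>C (T (x (r n)) - shift_op T l (x (r n))) = x (r n)" for n
    using l(1) by (simp add: shift_op_def scaleC_scaleC scaleC_one)
  ultimately have lim: "(\<lambda>n. x (r n)) \<longlonglongrightarrow> inverse l *\<^sub>C y" by simp
  let ?z = "inverse l *\<^sub>C y"
  have "norm ?z = 1" using LIMSEQ_unique[OF tendsto_norm[OF lim]] x(1) by simp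
  moreover have "T ?z = l *\<^sub>C ?z"
  proof -
    have "(\<lambda>n. T (x (r n))) \<longlonglongrightarrow> T ?z" 
      using bounded_linear.tendsto[OF bounded_clinear_linear[OF T] lim] .
    moreover have "(\<lambda>n. T (x (r n))) \<longlonglongrightarrow> y" using y by (simp add: o_def)
    ultimately have "T ?z = y" by (rule LIMSEQ_unique)
    then show ?thesis using l by (simp add: scaleC_scaleC scaleC_one)
  qed
  ultimately have "l \<in> eigenvalues T"
    unfolding eigenvalues_def by (intro CollectI exI[of _ ?z]) (auto simp del: complex_vector.scale_eq_0_iff)
  then show False using l by blast
qed

lemma compact_tame:
  fixes T :: "'a::complex_banach \<Rightarrow> 'a"
  assumes T: "bounded_clinear T" and com: "compact_op T"
  shows "tame T"
proof (rule countable_approximate_point_spectrum_tame[OF T])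
  have "eigenvalues T \<subseteq> insert 0 (\<Union>n. {l \<in> eigenvalues T. 1 / real (Suc n) \<le> cmod l})"
  proof
    fix l assume l: "l \<in> eigenvalues T"
    show "l \<in> insert 0 (\<Union>n. {l \<in> eigenvalues T. 1 / real (Suc n) \<le> cmod l})"
    proof (cases "l = 0")
      case False
      then obtain n where "inverse (real (Suc n)) < cmod l"
        using reals_Archimedean[of "cmod l"] by auto
      then have "l \<in> {l \<in> eigenvalues T. 1 / real (Suc n) \<le> cmod l}"
        using l by (simp add: inverse_eq_divide)
      then show ?thesis by blast
    qed simp
  qed
  moreover have "countable (\<Union>n. {l \<in> eigenvalues T. 1 / real (Suc n) \<le> cmod l})"
    using compact_op_finite_eigenvalues[OF T com]
    by (intro countable_UN countableI_type) (simp add: countable_finite)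
  ultimately show "countable (insert 0 (eigenvalues T))" by (meson countable_insert countable_subset)
qed (use compact_op_bounded_below[OF T com] in auto)

section \<open>Upper triangular operators\<close>

lemma bounded_clinear_upper_triangular_op:
  assumes A: "bounded_clinear A" and B: "bounded_clinear B" and C: "bounded_clinear C"
  shows "bounded_clinear (upper_triangular_op A B C)"
proof -
  have "bounded_linear (\<lambda>z. A (fst z))" "bounded_linear (\<lambda>z. C (snd z))" "bounded_linear (\<lambda>z. B (snd z))"
    using bounded_linear_compose[OF bounded_clinear_linear[OF A] bounded_linear_fst]
      bounded_linear_compose[OF bounded_clinear_linear[OF B] bounded_linear_snd]
      bounded_linear_compose[OF bounded_clinear_linear[OF C] bounded_linear_snd] by blast+
  then have "bounded_linear (\<lambda>z. (A (fst z) + C (snd z), B (snd z)))"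
    by (intro bounded_linear_Pair bounded_linear_add)
  then show ?thesis
    by (simp add: bounded_clinear_def upper_triangular_op_def case_prod_beta' scaleC_prod_def
        bounded_clinear_scaleC[OF A] bounded_clinear_scaleC[OF B] bounded_clinear_scaleC[OF C]
        scaleC_add_right)
qed

lemma shift_op_upper_triangular_op:
  "shift_op (upper_triangular_op A B C) l = upper_triangular_op (shift_op A l) (shift_op B l) C"
  by (auto simp: shift_op_def upper_triangular_op_def scaleC_prod_def)

lemma upper_triangular_op_bounded_below_first:
  assumes B: "bounded_clinear B" and C: "bounded_clinear C"
    and M: "bounded_below_on UNIV (upper_triangular_op A B C)"
  shows "bounded_below_on UNIV A"
proof -
  obtain c where c: "c > 0" "\<And>z. c * norm z \<le> norm (upper_triangular_op A B C z)"
    using M by (auto simp: bounded_below_on_def)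
  have "c * norm x \<le> norm (A x)" for x
    using c(2)[of "(x, 0)"]
    by (simp add: upper_triangular_op_def bounded_clinear_zero[OF B] bounded_clinear_zero[OF C] norm_Pair)
  then show ?thesis using c(1) by (auto simp: bounded_below_on_def)
qed

text \<open>Surjectivity of \<open>A\<close> makes it possible to complete \<open>y\<close> to a vector \<open>(x, y)\<close> whose image is
  \<open>(0, B y)\<close>.\<close>
lemma upper_triangular_op_bounded_below_second:
  assumes A: "bounded_clinear A" "range A = UNIV"
    and M: "bounded_below_on UNIV (upper_triangular_op A B C)"
  shows "bounded_below_on UNIV B"
proof -
  obtain c where c: "c > 0" "\<And>z. c * norm z \<le> norm (upper_triangular_op A B C z)"
    using M by (auto simp: bounded_below_on_def)
  have "c * norm y \<le> norm (B y)" for y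
  proof -
    obtain x where x: "A x = - C y" using A(2) by (metis UNIV_I imageE)
    have "c * norm y \<le> c * norm (x, y)" using c(1) norm_snd_le[of y x] by (simp add: mult_left_mono)
    also have "\<dots> \<le> norm (B y)"
      using c(2)[of "(x, y)"] x by (simp add: upper_triangular_op_def norm_Pair)
    finally show ?thesis .
  qed
  then show ?thesis using c(1) by (auto simp: bounded_below_on_def)
qed

lemma upper_triangular_op_bounded_below:
  assumes C: "bounded_clinear C"
    and A: "bounded_below_on UNIV A" and B: "bounded_below_on UNIV B"
  shows "bounded_below_on UNIV (upper_triangular_op A B C)"
proof -
  obtain a where a: "a > 0" "\<And>x. a * norm x \<le> norm (A x)" using A by (auto simp: bounded_below_on_def)
  obtain b where b: "b > 0" "\<And>y. b * norm y \<le> norm (B y)" using B by (auto simp: bounded_below_on_def)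
  obtain k where k: "k > 0" "\<And>y. norm (C y) \<le> k * norm y" using bounded_clinear_bound[OF C] by blast
  define q where "q = (1 + k / b) / a + 1 / b"
  have q: "q > 0" using a b k by (auto simp: q_def intro!: add_pos_pos divide_pos_pos)
  have "inverse q * norm z \<le> norm (upper_triangular_op A B C z)" for z
  proof -
    obtain x y where z: "z = (x, y)" by fastforce
    let ?n = "norm (upper_triangular_op A B C z)"
    have 1: "norm (A x + C y) \<le> ?n" "norm (B y) \<le> ?n"
      using norm_fst_le[of "A x + C y" "B y"] norm_snd_le[of "B y" "A x + C y"]
      by (simp_all add: z upper_triangular_op_def)
    have y: "norm y \<le> ?n / b" using b(2)[of y] 1(2) b(1) by (simp add: field_simps)
    have "a * norm x \<le> norm (A x)" by (rule a)
    also have "\<dots> \<le> norm (A x + C y) + norm (C y)"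
      using norm_triangle_ineq4[of "A x + C y" "C y"] by simp
    also have "\<dots> \<le> ?n + k * (?n / b)"
      using 1(1) k(2)[of y] mult_left_mono[OF y, of k] k(1) by linarith
    finally have x: "norm x \<le> (1 + k / b) / a * ?n" using a(1) by (simp add: field_simps)
    have "norm z \<le> norm x + norm y" by (simp add: z norm_Pair_le)
    also have "\<dots> \<le> q * ?n" using x y by (simp add: q_def distrib_right)
    finally show ?thesis using q by (simp add: field_simps)
  qed
  then show ?thesis using q by (intro bounded_below_onI[of "inverse q"]) simp_all
qed

lemma upper_triangular_op_surj:
  assumes A: "bounded_clinear A" "range A = UNIV" and B: "range B = UNIV"
  shows "range (upper_triangular_op A B C) = UNIV"
proof -
  have "(u, v) \<in> range (upper_triangular_op A B C)" for u v
  proof -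
    obtain y where y: "B y = v" using B by (metis UNIV_I imageE)
    obtain x where "A x = u - C y" using A(2) by (metis UNIV_I imageE)
    then have "upper_triangular_op A B C (x, y) = (u, v)" using y by (simp add: upper_triangular_op_def)
    then show ?thesis by (metis rangeI)
  qed
  then show ?thesis by auto
qed

text \<open>A chain that starts at \<open>0\<close> is again a chain after dropping its first member.\<close>
lemma bounded_chain_vanishes:
  assumes zero: "\<And>y. bounded_chain T y \<Longrightarrow> y 0 = 0" and x: "bounded_chain T x"
  shows "x n = 0"
  using x
proof (induction n arbitrary: x)
  case (Suc n)
  have x0: "x 0 = 0" using zero Suc.prems by blast
  obtain D C where "\<And>n. norm (x n) \<le> D * C ^ n" using Suc.prems by (auto simp: bounded_chain_def)
  then have "norm (x (Suc n)) \<le> (D * C) * C ^ n" for n using \<open>\<And>n. norm (x n) \<le> D * C ^ n\<close>[of "Suc n"]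
    by (simp add: mult.assoc)
  then have "bounded_chain T (\<lambda>n. x (Suc n))"
    using Suc.prems x0 unfolding bounded_chain_def by auto
  then show ?case by (rule Suc.IH)
qed (rule zero)

text \<open>The second components of a chain form a chain of \<open>B - l\<close>, hence vanish, and then the first
  components form a chain of \<open>A - l\<close>. A lower bound for the triangular operator passes to \<open>A - l\<close>,
  which is then onto by tameness, and only because of that passes on to \<open>B - l\<close>.\<close>
lemma tame_upper_triangular_op:
  fixes A :: "'a::complex_banach \<Rightarrow> 'a" and B :: "'b::complex_banach \<Rightarrow> 'b"
  assumes A: "bounded_clinear A" "tame A" and B: "bounded_clinear B" "tame B" and C: "bounded_clinear C"
  shows "tame (upper_triangular_op A B C)"
  unfolding tame_def shift_op_upper_triangular_op
proof (intro allI conjI impI)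
  fix l and z :: "nat \<Rightarrow> 'a \<times> 'b"
  assume z: "bounded_chain (upper_triangular_op (shift_op A l) (shift_op B l) C) z"
  then obtain D E where b: "\<And>n. norm (z n) \<le> D * E ^ n" by (auto simp: bounded_chain_def)
  have "bounded_chain (shift_op B l) (\<lambda>n. snd (z n))"
    unfolding bounded_chain_def
  proof (intro conjI allI exI)
    show "norm (snd (z n)) \<le> D * E ^ n" for n
      using b[of n] norm_snd_le[of "snd (z n)" "fst (z n)"] by simp
  qed (use z in \<open>auto simp: bounded_chain_def upper_triangular_op_def case_prod_beta' prod_eq_iff\<close>)
  then have snd0: "snd (z n) = 0" for n
    using bounded_chain_vanishes[of "shift_op B l" "\<lambda>n. snd (z n)"] B(2) by (simp add: tame_def)
  have "bounded_chain (shift_op A l) (\<lambda>n. fst (z n))"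
    unfolding bounded_chain_def
  proof (intro conjI allI exI)
    show "norm (fst (z n)) \<le> D * E ^ n" for n
      using b[of n] norm_fst_le[of "fst (z n)" "snd (z n)"] by simp
  qed (use z snd0 in \<open>auto simp: bounded_chain_def upper_triangular_op_def case_prod_beta' prod_eq_iff
      bounded_clinear_zero[OF C]\<close>)
  then have "fst (z 0) = 0" using A(2) by (auto simp: tame_def)
  then show "z 0 = 0" using snd0 by (simp add: prod_eq_iff)
next
  fix l assume bb: "bounded_below_on UNIV (upper_triangular_op (shift_op A l) (shift_op B l) C)"
  have "bounded_below_on UNIV (shift_op A l)"
    using upper_triangular_op_bounded_below_first[OF bounded_clinear_shift_op[OF B(1)] C bb] .
  then have rA: "range (shift_op A l) = UNIV" using A(2) by (simp add: tame_def)
  have "bounded_below_on UNIV (shift_op B l)"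
    using upper_triangular_op_bounded_below_second[OF bounded_clinear_shift_op[OF A(1)] rA bb] .
  then have "range (shift_op B l) = UNIV" using B(2) by (simp add: tame_def)
  then show "range (upper_triangular_op (shift_op A l) (shift_op B l) C) = UNIV"
    using upper_triangular_op_surj[OF bounded_clinear_shift_op[OF A(1)] rA] by blast
qed

lemma tame_spectrum_iff:
  assumes "bounded_clinear T" "tame T"
  shows "l \<notin> spectrum_on UNIV T \<longleftrightarrow> bounded_below_on UNIV (shift_op T l)"
  using assms invertible_on_iff[OF bounded_clinear_shift_op[OF assms(1)], of UNIV l]
  by (auto simp: spectrum_on_def tame_def)

text \<open>For general \<open>A\<close> and \<open>B\<close> only one inclusion holds: the triangular operator may be invertible
  while \<open>A\<close> fails to be onto and \<open>B\<close> fails to be injective. Tameness of \<open>A\<close> excludes this.\<close>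
lemma spectrum_upper_triangular_op:
  fixes A :: "'a::complex_banach \<Rightarrow> 'a" and B :: "'b::complex_banach \<Rightarrow> 'b"
  assumes A: "bounded_clinear A" "tame A" and B: "bounded_clinear B" "tame B" and C: "bounded_clinear C"
  shows "spectrum_on UNIV (upper_triangular_op A B C) = spectrum_on UNIV A \<union> spectrum_on UNIV B"
proof -
  let ?M = "upper_triangular_op A B C"
  have "l \<notin> spectrum_on UNIV ?M \<longleftrightarrow> l \<notin> spectrum_on UNIV A \<and> l \<notin> spectrum_on UNIV B" for l
  proof -
    note sA = tame_spectrum_iff[OF A, of l] and sB = tame_spectrum_iff[OF B, of l]
    have sM: "l \<notin> spectrum_on UNIV ?M \<longleftrightarrow>
        bounded_below_on UNIV (upper_triangular_op (shift_op A l) (shift_op B l) C)"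
      using tame_spectrum_iff[OF bounded_clinear_upper_triangular_op[OF A(1) B(1) C]
          tame_upper_triangular_op[OF A B C], of l]
      by (simp add: shift_op_upper_triangular_op)
    show ?thesis
    proof
      assume "l \<notin> spectrum_on UNIV ?M"
      then have bb: "bounded_below_on UNIV (upper_triangular_op (shift_op A l) (shift_op B l) C)"
        using sM by blast
      have bA: "bounded_below_on UNIV (shift_op A l)"
        using upper_triangular_op_bounded_below_first[OF bounded_clinear_shift_op[OF B(1)] C bb] .
      then have "range (shift_op A l) = UNIV" using A(2) by (simp add: tame_def)
      then have "bounded_below_on UNIV (shift_op B l)"
        using upper_triangular_op_bounded_below_second[OF bounded_clinear_shift_op[OF A(1)] _ bb] by blast
      then show "l \<notin> spectrum_on UNIV A \<and> l \<notin> spectrum_on UNIV B" using bA sA sB by blast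
    next
      assume "l \<notin> spectrum_on UNIV A \<and> l \<notin> spectrum_on UNIV B"
      then show "l \<notin> spectrum_on UNIV ?M"
        using upper_triangular_op_bounded_below[OF C] sA sB sM by blast
    qed
  qed
  then show ?thesis by blast
qed

section \<open>Pseudo-Fredholm points of tame operators are isolated in the spectrum\<close>

lemma bounded_clinear_funpow:
  fixes T :: "'a::complex_normed_vector \<Rightarrow> 'a"
  shows "bounded_clinear T \<Longrightarrow> bounded_clinear (T ^^ n)"
proof (induction n)
  case 0
  have "T ^^ 0 = (\<lambda>x. x)" by auto
  then show ?case by (simp add: bounded_clinear_def bounded_linear_ident del: funpow.simps)
next
  case (Suc n)
  then show ?case
    using bounded_linear_compose[of T "T ^^ n"] by (simp add: bounded_clinear_def o_def)
qed

text \<open>Because the kernel lies in every \<open>(T ^^ n) ` M\<close>, every preimage in \<open>M\<close> of a vector of the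
  generalized range \<open>R\<close> is again in \<open>R\<close>. The preimages with norm control given by the open mapping
  theorem can thus be iterated within \<open>R\<close>.\<close>
lemma semi_regular_kernel_chain:
  fixes T :: "'a::complex_banach \<Rightarrow> 'a"
  assumes T: "bounded_clinear T" and M: "closed_invariant_subspace T M"
    and reg: "semi_regular_on M T" and v: "v \<in> M" "T v = 0"
  shows "\<exists>x. bounded_chain T x \<and> x 0 = v"
proof -
  note M' = closed_invariant_subspaceD[OF M]
  have cl: "closed (T ` M)" and ker: "\<And>u n. u \<in> M \<Longrightarrow> T u = 0 \<Longrightarrow> u \<in> (T ^^ n) ` M"
    using reg by (auto simp: semi_regular_on_def)
  obtain K where K: "K > 0" "\<And>y. y \<in> T ` M \<Longrightarrow> \<exists>x\<in>M. T x = y \<and> norm x \<le> K * norm y"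
    using open_mapping_on[OF bounded_clinear_linear[OF T] complex_subspace_imp_real[OF M'(1)] M'(2) cl]
    by blast
  define R where "R = (\<Inter>n. (T ^^ n) ` M)"
  have powM: "(T ^^ n) u \<in> M" if "u \<in> M" for n u
    using that M'(3) by (induction n) auto
  have pull: "u \<in> R" if u: "u \<in> M" "T u \<in> R" for u
    unfolding R_def
  proof (rule INT_I)
    fix n
    have "T u \<in> (T ^^ Suc n) ` M" using u(2) unfolding R_def by blast
    then obtain w where w: "w \<in> M" "T u = T ((T ^^ n) w)" by auto
    have "u - (T ^^ n) w \<in> (T ^^ n) ` M"
    proof (rule ker)
      show "u - (T ^^ n) w \<in> M" using u powM[OF w(1)] M'(1) by (simp add: complex_vector.subspace_diff)
      show "T (u - (T ^^ n) w) = 0" using w by (simp add: bounded_clinear_diff[OF T])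
    qed
    then obtain w' where w': "w' \<in> M" "u - (T ^^ n) w = (T ^^ n) w'" by blast
    have "u = (T ^^ n) (w + w')"
      using w'(2) by (simp add: bounded_clinear_add[OF bounded_clinear_funpow[OF T]] algebra_simps)
    then show "u \<in> (T ^^ n) ` M" using w(1) w'(1) M'(1) by (blast intro: complex_vector.subspace_add)
  qed
  have "\<exists>x. x \<in> R \<and> T x = y \<and> norm x \<le> K * norm y" if y: "y \<in> R" for y
  proof -
    have "y \<in> (T ^^ 1) ` M" using y unfolding R_def by blast
    then obtain x where "x \<in> M" "T x = y" "norm x \<le> K * norm y" using K(2)[of y] by auto
    then show ?thesis using pull y by blast
  qed
  then obtain p where p: "\<And>y. y \<in> R \<Longrightarrow> p y \<in> R" "\<And>y. y \<in> R \<Longrightarrow> T (p y) = y"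
    "\<And>y. y \<in> R \<Longrightarrow> norm (p y) \<le> K * norm y"
    by metis
  define x where "x n = (p ^^ n) v" for n
  have vR: "v \<in> R" unfolding R_def using ker v by blast
  have xR: "x n \<in> R" for n by (induction n) (simp_all add: x_def vR p)
  have "norm (x n) \<le> norm v * K ^ n" for n
  proof (induction n)
    case (Suc n)
    have "norm (x (Suc n)) \<le> K * norm (x n)" using p(3)[OF xR[of n]] by (simp add: x_def)
    also have "\<dots> \<le> K * (norm v * K ^ n)" using Suc K(1) by (simp add: mult_left_mono)
    finally show ?case by (simp add: mult_ac)
  qed (simp add: x_def)
  moreover have "T (x (Suc n)) = x n" for n using p(2)[OF xR[of n]] by (simp add: x_def)
  ultimately have "bounded_chain T x" using v(2) by (auto simp: bounded_chain_def x_def)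
  then show ?thesis by (auto simp: x_def)
qed

text \<open>The open mapping theorem for \<open>(x, y) \<mapsto> x + y\<close> on \<open>M \<times> N\<close> bounds the components of \<open>T z\<close>, which
  are the images of the components of \<open>z\<close>, by \<open>norm (T z)\<close>.\<close>
lemma bounded_below_on_direct_sum:
  fixes T :: "'a::complex_banach \<Rightarrow> 'a"
  assumes T: "bounded_clinear T" and M: "closed_invariant_subspace T M" and N: "closed_invariant_subspace T N"
    and sum: "{x + y | x y. x \<in> M \<and> y \<in> N} = UNIV" and int: "M \<inter> N = {0}"
    and bM: "bounded_below_on M T" and bN: "bounded_below_on N T"
  shows "bounded_below_on UNIV T"
proof -
  note M' = closed_invariant_subspaceD[OF M] and N' = closed_invariant_subspaceD[OF N]
  let ?add = "\<lambda>z::'a \<times> 'a. fst z + snd z"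
  have sumeq: "?add ` (M \<times> N) = UNIV"
  proof -
    have "z \<in> ?add ` (M \<times> N)" for z
    proof -
      obtain x y where "z = x + y" "x \<in> M" "y \<in> N" using sum by blast
      then show ?thesis by (intro image_eqI[of _ _ "(x, y)"]) auto
    qed
    then show ?thesis by blast
  qed
  obtain K where K: "K > 0" "\<And>z. \<exists>u\<in>M \<times> N. ?add u = z \<and> norm u \<le> K * norm z"
  proof (rule open_mapping_on[of ?add "M \<times> N"])
    show "bounded_linear ?add" by (intro bounded_linear_add bounded_linear_fst bounded_linear_snd)
    show "subspace (M \<times> N)"
      using M'(1) N'(1) by (intro subspace_Times complex_subspace_imp_real)
    show "closed (M \<times> N)" using M' N' by (intro closed_Times)
    show "closed (?add ` (M \<times> N))" by (simp only: sumeq closed_UNIV)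
  qed (use sumeq in blast)
  obtain m where m: "m > 0" "\<And>x. x \<in> M \<Longrightarrow> m * norm x \<le> norm (T x)" using bM by (auto simp: bounded_below_on_def)
  obtain n where n: "n > 0" "\<And>x. x \<in> N \<Longrightarrow> n * norm x \<le> norm (T x)" using bN by (auto simp: bounded_below_on_def)
  define q where "q = K / m + K / n"
  have q: "q > 0" using K m n by (auto simp: q_def intro: add_pos_pos)
  have "inverse q * norm z \<le> norm (T z)" for z
  proof -
    obtain x y where z: "z = x + y" "x \<in> M" "y \<in> N" using sum by blast
    obtain u where u: "u \<in> M \<times> N" "?add u = T z" "norm u \<le> K * norm (T z)" using K(2) by blast
    have T_mem: "T x \<in> M" "T y \<in> N" using z M'(3) N'(3) by blast+
    have eq: "fst u - T x = T y - snd u"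
      using u(2) by (simp add: z(1) bounded_clinear_add[OF T] algebra_simps)
    have "fst u - T x \<in> M" using u(1) T_mem M'(1) by (auto intro: complex_vector.subspace_diff)
    moreover have "fst u - T x \<in> N" unfolding eq using u(1) T_mem N'(1) by (auto intro: complex_vector.subspace_diff)
    ultimately have "fst u - T x = 0" using int by blast
    then have xy: "T x = fst u" "T y = snd u" using eq by simp_all
    have "norm x \<le> norm u / m" "norm y \<le> norm u / n"
      using m(2)[OF z(2)] n(2)[OF z(3)] norm_fst_le[of "fst u" "snd u"] norm_snd_le[of "snd u" "fst u"] m(1) n(1)
      by (simp_all add: xy field_simps)
    then have "norm x \<le> K / m * norm (T z)" "norm y \<le> K / n * norm (T z)"
      using divide_right_mono[OF u(3), of m] divide_right_mono[OF u(3), of n] m(1) n(1) by simp_all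
    moreover have "norm z \<le> norm x + norm y" using norm_triangle_ineq z(1) by blast
    ultimately have "norm z \<le> q * norm (T z)" unfolding q_def distrib_right by linarith
    then show ?thesis using q by (simp add: field_simps)
  qed
  then show ?thesis using q by (intro bounded_below_onI[of "inverse q"]) simp_all
qed

lemma closed_invariant_subspace_shift_op:
  "closed_invariant_subspace T M \<Longrightarrow> closed_invariant_subspace (shift_op T l) M"
  using shift_op_image_subset[of T M l] by (auto simp: closed_invariant_subspace_def)

text \<open>By tameness no nonzero kernel vector starts a chain, so the semi-regular part of \<open>T - l\<close> is
  injective with closed range, hence bounded below, and remains so near \<open>l\<close>. The quasinilpotent part
  is invertible at all other points. Thus \<open>T - m\<close> is bounded below on the whole space for \<open>m \<noteq> l\<close>
  near \<open>l\<close>, and tameness makes it invertible.\<close>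
lemma pseudo_fredholm_isolated:
  fixes T :: "'a::complex_banach \<Rightarrow> 'a"
  assumes T: "bounded_clinear T" "tame T" and pf: "pseudo_fredholm (shift_op T l)"
  shows "\<not> l islimpt spectrum_on UNIV T"
proof -
  let ?S = "shift_op T l"
  have S: "bounded_clinear ?S" using T(1) by (rule bounded_clinear_shift_op)
  obtain M N where M: "closed_invariant_subspace ?S M" and N: "closed_invariant_subspace ?S N"
    and sum: "{x + y | x y. x \<in> M \<and> y \<in> N} = UNIV" and int: "M \<inter> N = {0}"
    and reg: "semi_regular_on M ?S" and qn: "quasinilpotent_on N ?S"
    using pf unfolding pseudo_fredholm_def by blast
  note M' = closed_invariant_subspaceD[OF M] and N' = closed_invariant_subspaceD[OF N]
  have inj: "v = 0" if "v \<in> M" "?S v = 0" for v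
    using semi_regular_kernel_chain[OF S M reg that] T(2) unfolding tame_def by metis
  have "closed (?S ` M)" using reg by (simp add: semi_regular_on_def)
  then obtain K where K: "K > 0" "\<And>y. y \<in> ?S ` M \<Longrightarrow> \<exists>x\<in>M. ?S x = y \<and> norm x \<le> K * norm y"
    using open_mapping_on[OF bounded_clinear_linear[OF S] complex_subspace_imp_real[OF M'(1)] M'(2)]
    by blast
  have low: "inverse K * norm x \<le> norm (?S x)" if x: "x \<in> M" for x
  proof -
    obtain x' where x': "x' \<in> M" "?S x' = ?S x" "norm x' \<le> K * norm (?S x)" using K(2) x by blast
    then have "x' - x \<in> M" "?S (x' - x) = 0"
      using x M'(1) by (simp_all add: complex_vector.subspace_diff bounded_clinear_diff[OF S])
    then have "x' - x = 0" by (rule inj)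
    then show ?thesis using x'(3) K(1) by (simp add: field_simps)
  qed
  have "m \<notin> spectrum_on UNIV T" if m: "m \<noteq> l" "dist m l < inverse K" for m
  proof -
    have eq: "shift_op T m = shift_op ?S (m - l)" by (simp add: shift_op_shift_op)
    have "bounded_below_on M (shift_op T m)"
    proof (rule bounded_below_onI)
      show "0 < inverse K - cmod (m - l)" using m by (simp add: dist_norm)
    qed (use low shift_op_lower_bound in blast)
    moreover have "bounded_below_on N (shift_op T m)"
    proof -
      have "m - l \<notin> spectrum_on N ?S" using qn m by (auto simp: quasinilpotent_on_def)
      then show ?thesis unfolding eq using not_in_spectrum_on[OF S N] by blast
    qed
    ultimately have "bounded_below_on UNIV (shift_op T m)"
      using closed_invariant_subspace_shift_op[OF M, of "m - l"]
        closed_invariant_subspace_shift_op[OF N, of "m - l"]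
      by (intro bounded_below_on_direct_sum[OF bounded_clinear_shift_op[OF T(1)] _ _ sum int])
        (simp_all add: eq)
    then show ?thesis using tame_spectrum_iff[OF T] by blast
  qed
  moreover have "inverse K > 0" using K(1) by simp
  ultimately show ?thesis unfolding islimpt_approachable by blast
qed

section \<open>Means over circles\<close>

definition circle_mean :: "real \<Rightarrow> (complex \<Rightarrow> 'a::banach) \<Rightarrow> 'a"
  where "circle_mean r f = (1 / (2 * pi)) *\<^sub>R integral {0..2 * pi} (\<lambda>t. f (of_real r * cis t))"

lemma circle_mem: "0 \<le> r \<Longrightarrow> of_real r * cis t \<in> sphere 0 r"
  by (simp add: norm_mult)

lemma continuous_on_circle:
  assumes "continuous_on (sphere 0 r) f" "0 \<le> r"
  shows "continuous_on S (\<lambda>t. f (of_real r * cis t))"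
  by (rule continuous_on_compose2[OF assms(1)])
    (use assms(2) in \<open>auto intro!: continuous_intros simp: norm_mult\<close>)

lemma circle_integrable:
  fixes f :: "complex \<Rightarrow> 'a::banach"
  assumes "continuous_on (sphere 0 r) f" "0 \<le> r"
  shows "(\<lambda>t. f (of_real r * cis t)) integrable_on {0..2 * pi}"
  by (intro integrable_continuous_interval continuous_on_circle assms)

lemma circle_mean_cong:
  assumes "\<And>z. z \<in> sphere 0 r \<Longrightarrow> f z = g z" "0 \<le> r"
  shows "circle_mean r f = circle_mean r g"
  using assms circle_mem[OF assms(2)] by (simp add: circle_mean_def)

lemma circle_mean_add:
  assumes "continuous_on (sphere 0 r) f" "continuous_on (sphere 0 r) g" "0 \<le> r"
  shows "circle_mean r (\<lambda>z. f z + g z) = circle_mean r f + circle_mean r g"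
  using circle_integrable[OF assms(1,3)] circle_integrable[OF assms(2,3)]
  by (simp add: circle_mean_def integral_add scaleR_add_right)

lemma circle_mean_linear:
  assumes "continuous_on (sphere 0 r) f" "0 \<le> r" "bounded_linear L"
  shows "circle_mean r (\<lambda>z. L (f z)) = L (circle_mean r f)"
  using integral_linear[OF circle_integrable[OF assms(1,2)] assms(3)]
  by (simp add: circle_mean_def o_def linear_scale bounded_linear.linear[OF assms(3)])

lemma circle_mean_const: "circle_mean r (\<lambda>_. c) = c"
  by (simp add: circle_mean_def)

lemma circle_mean_scaleC:
  fixes w :: "complex \<Rightarrow> complex"
  assumes "continuous_on (sphere 0 r) w" "0 \<le> r"
  shows "circle_mean r (\<lambda>z. w z *\<^sub>C x) = circle_mean r w *\<^sub>C (x :: 'a::complex_banach)"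
  using circle_mean_linear[OF assms bounded_bilinear.bounded_linear_left[OF bounded_bilinear_scaleC]] .

lemma norm_circle_mean_le:
  assumes f: "continuous_on (sphere 0 r) f" and r: "0 \<le> r" and B: "\<And>z. z \<in> sphere 0 r \<Longrightarrow> norm (f z) \<le> B"
  shows "norm (circle_mean r f) \<le> B"
proof -
  have "norm (integral {0..2 * pi} (\<lambda>t. f (of_real r * cis t))) \<le> B * (2 * pi - 0)"
    using continuous_on_circle[OF f r] B circle_mem[OF r] by (intro integral_bound) auto
  then show ?thesis by (simp add: circle_mean_def field_simps)
qed

lemma circle_mean_swap:
  fixes F :: "complex \<Rightarrow> complex \<Rightarrow> 'a::banach"
  assumes F: "continuous_on (sphere 0 r \<times> sphere 0 s) (\<lambda>(z, w). F z w)" and r: "0 \<le> r" and s: "0 \<le> s"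
  shows "circle_mean r (\<lambda>z. circle_mean s (F z)) = circle_mean s (\<lambda>w. circle_mean r (\<lambda>z. F z w))"
proof -
  let ?F = "\<lambda>t u. F (of_real r * cis t) (of_real s * cis u)"
  have "continuous_on (cbox (0, 0) (2 * pi, 2 * pi)) (\<lambda>p. (\<lambda>(z, w). F z w) (of_real r * cis (fst p), of_real s * cis (snd p)))"
    by (rule continuous_on_compose2[OF F])
      (use r s in \<open>auto intro!: continuous_intros simp: norm_mult\<close>)
  then have "continuous_on (cbox (0, 0) (2 * pi, 2 * pi)) (\<lambda>(t, u). ?F t u)"
    by (simp add: case_prod_beta')
  then have "integral (cbox 0 (2 * pi)) (\<lambda>t. integral (cbox 0 (2 * pi)) (?F t)) =
      integral (cbox 0 (2 * pi)) (\<lambda>u. integral (cbox 0 (2 * pi)) (\<lambda>t. ?F t u))"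
    by (rule integral_swap_continuous)
  then show ?thesis by (simp add: circle_mean_def)
qed

text \<open>The radial derivative of \<open>f\<close> at \<open>r * cis t\<close> is \<open>1 / (r * \<i>)\<close> times its derivative with respect to the angle,
  and the latter has integral \<open>0\<close> over a full turn.\<close>
lemma circle_mean_radius_independent:
  fixes f f' :: "complex \<Rightarrow> 'a::complex_banach"
  assumes f: "\<And>z. a < cmod z \<Longrightarrow> cmod z < b \<Longrightarrow> (f has_derivative (\<lambda>h. h *\<^sub>C f' z)) (at z)"
    and f': "continuous_on {z. a < cmod z \<and> cmod z < b} f'"
    and rs: "0 \<le> a" "a < r" "r < b" "a < s" "s < b"
  shows "circle_mean r f = circle_mean s f"
proof -
  let ?U = "{a<..<b}"
  let ?I = "\<lambda>r. integral (cbox 0 (2 * pi)) (\<lambda>t. f (of_real r * cis t))"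
  have ann: "a < cmod (of_real r * cis t)" "cmod (of_real r * cis t) < b" if "r \<in> ?U" for r t
    using that rs by (simp_all add: norm_mult)
  have cf: "continuous_on {z. a < cmod z \<and> cmod z < b} f"
    using f has_derivative_continuous by (intro continuous_at_imp_continuous_on) blast
  have "(?I has_vector_derivative 0) (at r within ?U)" if r: "r \<in> ?U" for r
  proof -
    have "(?I has_vector_derivative integral (cbox 0 (2 * pi)) (\<lambda>t. cis t *\<^sub>C f' (of_real r * cis t))) (at r within ?U)"
    proof (rule leibniz_rule_vector_derivative)
      fix x t assume x: "x \<in> ?U"
      have "((\<lambda>x. of_real x * cis t) has_derivative (\<lambda>h. of_real h * cis t)) (at x within ?U)"
        by (intro derivative_eq_intros) auto
      from has_derivative_compose[OF this f[OF ann[OF x]]]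
      show "((\<lambda>x. f (of_real x * cis t)) has_vector_derivative cis t *\<^sub>C f' (of_real x * cis t)) (at x within ?U)"
        by (simp add: has_vector_derivative_def scaleC_scaleC flip: scaleC_of_real)
    next
      fix x assume x: "x \<in> ?U"
      have "continuous_on {0..2 * pi} (\<lambda>t. f (of_real x * cis t))"
        by (rule continuous_on_compose2[OF cf]) (use ann[OF x] in \<open>auto intro!: continuous_intros\<close>)
      then show "(\<lambda>t. f (of_real x * cis t)) integrable_on cbox 0 (2 * pi)"
        by (simp add: integrable_continuous_interval)
    next
      have "continuous_on (?U \<times> cbox 0 (2 * pi)) (\<lambda>p. cis (snd p) *\<^sub>C f' (of_real (fst p) * cis (snd p)))"
        by (intro continuous_on_scaleC continuous_on_compose2[OF f'])
          (use ann in \<open>auto intro!: continuous_intros\<close>)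
      then show "continuous_on (?U \<times> cbox 0 (2 * pi)) (\<lambda>(x, t). cis t *\<^sub>C f' (of_real x * cis t))"
        by (simp add: case_prod_beta')
    qed (use r in auto)
    also have "integral (cbox 0 (2 * pi)) (\<lambda>t. cis t *\<^sub>C f' (of_real r * cis t)) = 0"
    proof -
      have "r \<noteq> 0" using r rs by auto
      have "((\<lambda>t. (of_real r * (\<i> * cis t)) *\<^sub>C f' (of_real r * cis t)) has_integral
          f (of_real r * cis (2 * pi)) - f (of_real r * cis 0)) {0..2 * pi}"
      proof (rule fundamental_theorem_of_calculus)
        fix t
        have "((\<lambda>t. of_real r * cis t) has_derivative (\<lambda>h. h *\<^sub>R (of_real r * (\<i> * cis t)))) (at t within {0..2 * pi})"
          by (auto intro!: derivative_eq_intros simp: scaleR_conv_of_real algebra_simps)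
        from has_derivative_compose[OF this f[OF ann[OF r]]]
        show "((\<lambda>t. f (of_real r * cis t)) has_vector_derivative
            (of_real r * (\<i> * cis t)) *\<^sub>C f' (of_real r * cis t)) (at t within {0..2 * pi})"
          by (simp add: has_vector_derivative_def scaleR_conv_of_real scaleC_scaleC flip: scaleC_of_real)
      qed simp
      then have "((\<lambda>t. (of_real r * (\<i> * cis t)) *\<^sub>C f' (of_real r * cis t)) has_integral 0) {0..2 * pi}"
        by simp
      moreover have cancel: "inverse (of_real r * \<i>) * (of_real r * (\<i> * cis t)) = cis t" for t
        using \<open>r \<noteq> 0\<close> by (simp add: field_simps)
      note has_integral_linear[OF calculation bounded_clinear_linear[OF bounded_clinear_scaleC_left[of "inverse (of_real r * \<i>)"]]]
      then have "((\<lambda>t. cis t *\<^sub>C f' (of_real r * cis t)) has_integral 0) {0..2 * pi}"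
        by (simp only: o_def scaleC_scaleC cancel complex_vector.scale_zero_right)
      then show ?thesis by (simp add: integral_unique)
    qed
    finally show ?thesis .
  qed
  then obtain c where "\<And>r. r \<in> ?U \<Longrightarrow> ?I r = c"
    using has_vector_derivative_zero_constant[of ?U ?I] by (auto simp: convex_real_interval)
  then have "?I r = ?I s" using rs by simp
  then show ?thesis by (simp add: circle_mean_def)
qed

lemma has_derivative_scaleC_field:
  "(f has_field_derivative f') (at z) \<Longrightarrow> (f has_derivative (\<lambda>h. h *\<^sub>C f')) (at z)"
  by (simp add: has_field_derivative_def scaleC_complex_def mult.commute[of _ f'])

text \<open>The mean does not depend on the radius \<open>r < cmod w\<close>, and its norm is at most \<open>r / (cmod w - r)\<close>,
  which tends to \<open>0\<close> with \<open>r\<close>.\<close>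
lemma circle_mean_pole_outside:
  assumes "0 < r" "r < cmod w"
  shows "circle_mean r (\<lambda>z. z / (z - w)) = 0"
proof -
  have w: "cmod w > 0" using assms by linarith
  have ne: "z - w \<noteq> 0" if "cmod z < cmod w" for z using that by auto
  have "norm (circle_mean r (\<lambda>z. z / (z - w))) \<le> e" if e: "e > 0" for e
  proof -
    \<comment> \<open>The radius for which the bound \<open>s / (cmod w - s)\<close> is exactly \<open>e\<close>.\<close>
    define s where "s = e * cmod w / (1 + e)"
    have "cmod w - s = cmod w / (1 + e)" using e by (simp add: s_def field_simps)
    then have s: "0 < s" "s < cmod w" "s / (cmod w - s) = e"
      using e w by (simp_all add: s_def divide_less_eq)
    have "circle_mean r (\<lambda>z. z / (z - w)) = circle_mean s (\<lambda>z. z / (z - w))"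
    proof (rule circle_mean_radius_independent)
      show "((\<lambda>z. z / (z - w)) has_derivative (\<lambda>h. h *\<^sub>C (- w / (z - w)\<^sup>2))) (at z)"
        if "cmod z < cmod w" for z
        using ne[OF that] by (intro has_derivative_scaleC_field)
          (auto intro!: derivative_eq_intros simp: power2_eq_square field_simps)
      show "continuous_on {z. 0 < cmod z \<and> cmod z < cmod w} (\<lambda>z. - w / (z - w)\<^sup>2)"
        using ne by (intro continuous_intros) auto
    qed (use assms s in auto)
    also have "norm \<dots> \<le> e"
    proof (rule norm_circle_mean_le)
      show "continuous_on (sphere 0 s) (\<lambda>z. z / (z - w))"
        using ne s by (intro continuous_intros) auto
      fix z :: complex assume "z \<in> sphere 0 s"
      then have "cmod z = s" by simp
      then have "cmod w - s \<le> cmod (z - w)" using norm_triangle_ineq2[of w z] by (simp add: norm_minus_commute)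
      then have "cmod z / cmod (z - w) \<le> s / (cmod w - s)"
        using s \<open>cmod z = s\<close> by (intro frac_le) auto
      then show "norm (z / (z - w)) \<le> e" using s by (simp add: norm_divide)
    qed (use s in auto)
    finally show ?thesis .
  qed
  then have "norm (circle_mean r (\<lambda>z. z / (z - w))) \<le> 0" by (rule dense_ge)
  then show ?thesis by simp
qed

text \<open>Since \<open>z / (z - w) = 1 + w / (z - w)\<close>, it remains to see that the last term has mean \<open>0\<close>. Its mean
  does not depend on the radius \<open>r > cmod w\<close> and tends to \<open>0\<close> as \<open>r\<close> tends to infinity.\<close>
lemma circle_mean_pole_inside:
  assumes "cmod w < r"
  shows "circle_mean r (\<lambda>z. z / (z - w)) = 1"
proof -
  have r: "0 < r" using assms norm_ge_zero[of w] by linarith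
  have ne: "z - w \<noteq> 0" if "cmod w < cmod z" for z using that by auto
  have cont: "continuous_on (sphere 0 s) (\<lambda>z. w / (z - w))" if "cmod w < s" for s
    using ne that by (intro continuous_intros) auto
  have "norm (circle_mean r (\<lambda>z. w / (z - w))) \<le> e" if e: "e > 0" for e
  proof -
    define s where "s = cmod w + (cmod w + 1) / e"
    have s: "cmod w < s" "s - cmod w = (cmod w + 1) / e" using e by (simp_all add: s_def add_nonneg_pos)
    have "circle_mean r (\<lambda>z. w / (z - w)) = circle_mean s (\<lambda>z. w / (z - w))"
    proof (rule circle_mean_radius_independent[where b = "r + s + 1"])
      show "((\<lambda>z. w / (z - w)) has_derivative (\<lambda>h. h *\<^sub>C (- w / (z - w)\<^sup>2))) (at z)"
        if "cmod w < cmod z" for z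
        using ne[OF that] by (intro has_derivative_scaleC_field)
          (auto intro!: derivative_eq_intros simp: power2_eq_square field_simps)
      show "continuous_on {z. cmod w < cmod z \<and> cmod z < r + s + 1} (\<lambda>z. - w / (z - w)\<^sup>2)"
        using ne by (intro continuous_intros) auto
      show "r < r + s + 1" "s < r + s + 1" using r s norm_ge_zero[of w] by linarith+
    qed (use assms s in auto)
    also have "norm \<dots> \<le> e"
    proof (rule norm_circle_mean_le[OF cont[OF s(1)]])
      show "0 \<le> s" using s norm_ge_zero[of w] by linarith
      fix z :: complex assume "z \<in> sphere 0 s"
      then have "s - cmod w \<le> cmod (z - w)" using norm_triangle_ineq2[of z w] by simp
      then have "cmod w / cmod (z - w) \<le> (cmod w + 1) / (s - cmod w)"
        using s by (intro frac_le) auto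
      also have "\<dots> = e" unfolding s(2) using e by (simp add: add_nonneg_eq_0_iff)
      finally show "norm (w / (z - w)) \<le> e" by (simp add: norm_divide)
    qed
    finally show ?thesis .
  qed
  then have "norm (circle_mean r (\<lambda>z. w / (z - w))) \<le> 0" by (rule dense_ge)
  then have 0: "circle_mean r (\<lambda>z. w / (z - w)) = 0" by simp
  have "circle_mean r (\<lambda>z. z / (z - w)) = circle_mean r (\<lambda>z. 1 + w / (z - w))"
  proof (rule circle_mean_cong)
    fix z :: complex assume "z \<in> sphere 0 r"
    then have "cmod z = r" by simp
    with assms have "cmod w < cmod z" by (simp only:)
    then have "z - w \<noteq> 0" by (rule ne)
    have "z / (z - w) = ((z - w) + w) / (z - w)" by simp
    also have "\<dots> = (z - w) / (z - w) + w / (z - w)" by (rule add_divide_distrib)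
    also have "(z - w) / (z - w) = 1" using \<open>z - w \<noteq> 0\<close> by (rule divide_self)
    finally show "z / (z - w) = 1 + w / (z - w)" .
  qed (use r in simp)
  also have "\<dots> = 1 + circle_mean r (\<lambda>z. w / (z - w))"
    using circle_mean_add[OF continuous_on_const cont[OF assms], of 1] r by (simp add: circle_mean_const)
  finally show ?thesis using 0 by simp
qed

section \<open>The Riesz projection at an isolated point of the spectrum\<close>

lemma bounded_clinear_inverse:
  assumes T: "bounded_clinear T" and S: "\<And>x. S (T x) = x" "\<And>x. T (S x) = x"
    and K: "\<And>x. norm (S x) \<le> K * norm x"
  shows "bounded_clinear S"
  unfolding bounded_clinear_def
proof
  have "S (x + y) = S x + S y" for x y
    using S(1)[of "S x + S y"] by (simp add: bounded_clinear_add[OF T] S)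
  moreover have sc: "S (c *\<^sub>C x) = c *\<^sub>C S x" for c x
    using S(1)[of "c *\<^sub>C S x"] by (simp add: bounded_clinear_scaleC[OF T] S)
  ultimately show "bounded_linear S"
    using K by (intro bounded_linear_intro[of S K]) (auto simp: mult.commute simp flip: scaleC_of_real)
  show "\<forall>c x. S (c *\<^sub>C x) = c *\<^sub>C S x" using sc by blast
qed

text \<open>Caratheodory's form of the derivative, which fits the resolvent identity literally.\<close>
lemma has_derivative_of_difference_quotient:
  fixes f g :: "complex \<Rightarrow> 'a::complex_banach"
  assumes U: "open U" "m \<in> U" and fg: "\<And>n. n \<in> U \<Longrightarrow> f n - f m = (n - m) *\<^sub>C g n"
    and g: "continuous_on U g"
  shows "(f has_derivative (\<lambda>h. h *\<^sub>C g m)) (at m)"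
  unfolding has_derivative_iff_norm
proof
  show "bounded_linear (\<lambda>h. h *\<^sub>C g m)"
    by (rule bounded_bilinear.bounded_linear_left[OF bounded_bilinear_scaleC])
  have "(g \<longlongrightarrow> g m) (at m)"
    using g U by (simp add: continuous_on_eq_continuous_at isCont_def)
  then have "((\<lambda>n. norm (g n - g m)) \<longlongrightarrow> 0) (at m)"
    by (simp add: LIM_zero tendsto_norm_zero)
  moreover have "\<forall>\<^sub>F n in at m. norm (g n - g m) = norm (f n - f m - (n - m) *\<^sub>C g m) / norm (n - m)"
  proof -
    have "\<forall>\<^sub>F n in at m. n \<in> U \<and> n \<noteq> m" using U by (auto simp: eventually_at_topological)
    then show ?thesis
    proof (rule eventually_mono)
      fix n assume n: "n \<in> U \<and> n \<noteq> m"
      then have "f n - f m - (n - m) *\<^sub>C g m = (n - m) *\<^sub>C (g n - g m)"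
        by (simp add: fg scaleC_diff_right)
      then show "norm (g n - g m) = norm (f n - f m - (n - m) *\<^sub>C g m) / norm (n - m)"
        using n by (simp only: norm_scaleC) simp
    qed
  qed
  ultimately show "((\<lambda>n. norm (f n - f m - (n - m) *\<^sub>C g m) / norm (n - m)) \<longlongrightarrow> 0) (at m)"
    by (rule Lim_transform_eventually)
qed

text \<open>The origin is a regular value or an isolated point of the spectrum of \<open>T\<close>, with resolvent \<open>R\<close>.
  All integrals are taken pointwise, of \<open>R m x\<close> for a fixed vector \<open>x\<close>.\<close>
locale punctured_resolvent =
  fixes T :: "'a::complex_banach \<Rightarrow> 'a" and R :: "complex \<Rightarrow> 'a \<Rightarrow> 'a" and d :: real
  assumes T: "bounded_clinear T" and d: "d > 0"
    and R: "\<And>m. 0 < cmod m \<Longrightarrow> cmod m < d \<Longrightarrow> bounded_clinear (R m)"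
    and RT: "\<And>m x. 0 < cmod m \<Longrightarrow> cmod m < d \<Longrightarrow> R m (shift_op T m x) = x"
    and TR: "\<And>m x. 0 < cmod m \<Longrightarrow> cmod m < d \<Longrightarrow> shift_op T m (R m x) = x"
begin

definition punctured_disc :: "complex set" where "punctured_disc = {m. 0 < cmod m \<and> cmod m < d}"

lemma open_punctured_disc: "open punctured_disc"
  unfolding punctured_disc_def by (rule open_Collect_conj; intro open_Collect_less continuous_intros)

lemma R_bounded_clinear: "m \<in> punctured_disc \<Longrightarrow> bounded_clinear (R m)"
  and R_shift_op: "m \<in> punctured_disc \<Longrightarrow> R m (shift_op T m x) = x"
  and shift_op_R: "m \<in> punctured_disc \<Longrightarrow> shift_op T m (R m x) = x"
  using R RT TR by (auto simp: punctured_disc_def)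

lemma T_R: "m \<in> punctured_disc \<Longrightarrow> T (R m x) = x + m *\<^sub>C R m x"
  using shift_op_R[of m x] by (simp add: shift_op_def algebra_simps)

lemma R_T: "m \<in> punctured_disc \<Longrightarrow> R m (T x) = x + m *\<^sub>C R m x"
  using R_shift_op[of m x] by (simp add: shift_op_def bounded_clinear_diff[OF R_bounded_clinear] bounded_clinear_scaleC[OF R_bounded_clinear] algebra_simps)

lemma resolvent_identity:
  assumes "m \<in> punctured_disc" "n \<in> punctured_disc"
  shows "R m x - R n x = (m - n) *\<^sub>C R m (R n x)"
  using R_T[OF assms(1), of "R n x"]
  by (simp add: T_R[OF assms(2)] bounded_clinear_add[OF R_bounded_clinear[OF assms(1)]]
      bounded_clinear_scaleC[OF R_bounded_clinear[OF assms(1)]] scaleC_diff_left algebra_simps)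

lemma R_commute:
  assumes "m \<in> punctured_disc" "n \<in> punctured_disc"
  shows "R m (R n x) = R n (R m x)"
proof (cases "m = n")
  case False
  have "(m - n) *\<^sub>C R m (R n x) = R m x - R n x" by (rule resolvent_identity[OF assms, symmetric])
  also have "\<dots> = - (R n x - R m x)" by simp
  also have "\<dots> = - ((n - m) *\<^sub>C R n (R m x))" by (simp only: resolvent_identity[OF assms(2,1)])
  also have "\<dots> = (m - n) *\<^sub>C R n (R m x)" by (simp add: scaleC_diff_left)
  finally show ?thesis using False by (simp only: complex_vector.scale_cancel_left) simp
qed simp

text \<open>The resolvent identity bounds \<open>R n x\<close> by \<open>R m x\<close> and a multiple of \<open>R n x\<close> with a factor below
  \<open>1 / 2\<close>, which is absorbed on the left.\<close>
lemma R_local_bound: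
  assumes m: "m \<in> punctured_disc"
  obtains K where "K > 0" "\<And>n x. n \<in> punctured_disc \<Longrightarrow> cmod (n - m) * K < 1 \<Longrightarrow> norm (R n x) \<le> K * norm x"
proof -
  obtain K where K: "K > 0" "\<And>x. norm (R m x) \<le> K * norm x" using bounded_clinear_bound[OF R_bounded_clinear[OF m]] by blast
  have "norm (R n x) \<le> 2 * K * norm x" if n: "n \<in> punctured_disc" "cmod (n - m) * (2 * K) < 1" for n x
  proof -
    have "R n x = R m x + (n - m) *\<^sub>C R m (R n x)"
      using resolvent_identity[OF n(1) m, of x] R_commute[OF n(1) m] by (simp add: algebra_simps)
    then have "norm (R n x) \<le> norm (R m x) + cmod (n - m) * norm (R m (R n x))"
      by (metis norm_scaleC norm_triangle_ineq)
    also have "\<dots> \<le> K * norm x + cmod (n - m) * (K * norm (R n x))"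
      by (intro add_mono mult_left_mono K) auto
    also have "cmod (n - m) * (K * norm (R n x)) \<le> 1 / 2 * norm (R n x)"
      using mult_right_mono[of "cmod (n - m) * K" "1 / 2" "norm (R n x)"] n(2) by (simp add: mult.assoc)
    finally show ?thesis by simp
  qed
  then show ?thesis using that[of "2 * K"] K(1) by simp
qed

lemma continuous_on_R: "continuous_on (punctured_disc \<times> UNIV) (\<lambda>(m, x). R m x)"
  unfolding continuous_on_def
proof (intro ballI)
  fix p assume "p \<in> punctured_disc \<times> (UNIV :: 'a set)"
  then obtain m x where p: "p = (m, x)" "m \<in> punctured_disc" by blast
  obtain K where K: "K > 0" "\<And>n x. n \<in> punctured_disc \<Longrightarrow> cmod (n - m) * K < 1 \<Longrightarrow> norm (R n x) \<le> K * norm x"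
    using R_local_bound[OF p(2)] by blast
  let ?F = "at p within punctured_disc \<times> UNIV"
  let ?b = "\<lambda>q. K * norm (snd q - x) + cmod (fst q - m) * (K * norm (R m x))"
  have "((\<lambda>q. (case q of (n, y) \<Rightarrow> R n y) - R m x) \<longlongrightarrow> 0) ?F"
  proof (rule Lim_null_comparison)
    have "((\<lambda>q. cmod (fst q - m) * K) \<longlongrightarrow> cmod (fst p - m) * K) ?F"
      by (intro tendsto_intros)
    then have "\<forall>\<^sub>F q in ?F. cmod (fst q - m) * K < 1" by (rule order_tendstoD) (simp add: p)
    moreover have "\<forall>\<^sub>F q in ?F. q \<in> punctured_disc \<times> UNIV" by (simp add: eventually_at_filter)
    ultimately show "\<forall>\<^sub>F q in ?F. norm ((case q of (n, y) \<Rightarrow> R n y) - R m x) \<le> ?b q"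
    proof eventually_elim
      case (elim q)
      then obtain n y where q: "q = (n, y)" "n \<in> punctured_disc" "cmod (n - m) * K < 1" by (cases q) auto
      have "R n y - R m x = R n (y - x) + (n - m) *\<^sub>C R n (R m x)"
        using resolvent_identity[OF q(2) p(2), of x]
        by (simp add: bounded_clinear_diff[OF R_bounded_clinear[OF q(2)]] flip: resolvent_identity[OF q(2) p(2), of x])
      also have "norm \<dots> \<le> K * norm (y - x) + cmod (n - m) * (K * norm (R m x))"
        by (rule order_trans[OF norm_triangle_ineq], unfold norm_scaleC)
          (intro add_mono mult_left_mono K q, auto)
      finally show ?case by (simp add: q(1))
    qed
    have "(?b \<longlongrightarrow> K * norm (snd p - x) + cmod (fst p - m) * (K * norm (R m x))) ?F"
      by (intro tendsto_intros)
    then show "(?b \<longlongrightarrow> 0) ?F" by (simp add: p)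
  qed
  then show "((\<lambda>(m, x). R m x) \<longlongrightarrow> (case p of (m, x) \<Rightarrow> R m x)) ?F"
    by (simp add: p LIM_zero_cancel)
qed

lemma continuous_on_R_compose:
  assumes "continuous_on S f" "continuous_on S g" "f ` S \<subseteq> punctured_disc"
  shows "continuous_on S (\<lambda>s. R (f s) (g s))"
  using continuous_on_compose2[OF continuous_on_R continuous_on_Pair[OF assms(1,2)]] assms(3)
  by (auto simp: image_subset_iff)

lemma sphere_punctured_disc: "0 < r \<Longrightarrow> r < d \<Longrightarrow> sphere 0 r \<subseteq> punctured_disc"
  by (auto simp: punctured_disc_def)

text \<open>With weight \<open>- m\<close> this is the Riesz projection, because \<open>R m\<close> inverts \<open>T - m\<close> and not \<open>m - T\<close>. With weight
  \<open>m / (m - n)\<close> it is a Cauchy transform of the resolvent, which inverts \<open>T - n\<close> up to sign on the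
  range of the projection if \<open>n\<close> is outside the circle and on its kernel if \<open>n\<close> is inside.\<close>
definition weighted_mean :: "real \<Rightarrow> (complex \<Rightarrow> complex) \<Rightarrow> 'a \<Rightarrow> 'a"
  where "weighted_mean r w x = circle_mean r (\<lambda>m. w m *\<^sub>C R m x)"

context
  fixes r :: real and w :: "complex \<Rightarrow> complex"
  assumes r: "0 < r" "r < d" and w: "continuous_on (sphere 0 r) w"
begin

lemma continuous_on_weighted: "continuous_on (sphere 0 r) (\<lambda>m. w m *\<^sub>C R m x)"
  using w sphere_punctured_disc[OF r] by (intro continuous_on_scaleC continuous_on_R_compose continuous_intros) auto

lemma weighted_mean_commute:
  assumes L: "bounded_clinear L" "\<And>m x. m \<in> punctured_disc \<Longrightarrow> L (R m x) = R m (L x)"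
  shows "L (weighted_mean r w x) = weighted_mean r w (L x)"
proof -
  have "L (weighted_mean r w x) = circle_mean r (\<lambda>m. L (w m *\<^sub>C R m x))"
    unfolding weighted_mean_def
    using circle_mean_linear[OF continuous_on_weighted _ bounded_clinear_linear[OF L(1)]] r by simp
  also have "\<dots> = weighted_mean r w (L x)"
    unfolding weighted_mean_def using sphere_punctured_disc[OF r] r
    by (intro circle_mean_cong) (auto simp: bounded_clinear_scaleC[OF L(1)] L(2))
  finally show ?thesis .
qed

lemma R_sphere_bound: "\<exists>K. \<forall>m\<in>sphere 0 r. \<forall>x. norm (R m x) \<le> K * norm x"
proof -
  have "\<forall>m\<in>sphere 0 r. \<exists>K>0. \<forall>n\<in>punctured_disc. cmod (n - m) * K < 1 \<longrightarrow> (\<forall>x. norm (R n x) \<le> K * norm x)"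
    using R_local_bound sphere_punctured_disc[OF r] by (metis subsetD)
  then obtain K where K: "\<And>m. m \<in> sphere 0 r \<Longrightarrow> K m > 0"
    "\<And>m n x. m \<in> sphere 0 r \<Longrightarrow> n \<in> punctured_disc \<Longrightarrow> cmod (n - m) * K m < 1 \<Longrightarrow> norm (R n x) \<le> K m * norm x"
    by metis
  have "sphere 0 r \<subseteq> (\<Union>m\<in>sphere 0 r. ball m (1 / K m))" using K(1) by force
  then obtain C where C: "C \<subseteq> sphere 0 r" "finite C" "sphere 0 r \<subseteq> (\<Union>m\<in>C. ball m (1 / K m))"
    using compactE_image[OF compact_sphere[of 0 r], of "sphere 0 r" "\<lambda>m. ball m (1 / K m)"] by auto
  have "norm (R n x) \<le> (\<Sum>m\<in>C. K m) * norm x" if n: "n \<in> sphere 0 r" for n x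
  proof -
    obtain m where m: "m \<in> C" "n \<in> ball m (1 / K m)" using C(3) n by blast
    then have "0 < K m" using C(1) K(1) by blast
    then have "cmod (n - m) * K m < 1" using m(2) by (simp add: dist_norm norm_minus_commute field_simps)
    then have "norm (R n x) \<le> K m * norm x" using m(1) C(1) n sphere_punctured_disc[OF r] by (intro K(2)) auto
    also have "\<dots> \<le> (\<Sum>m\<in>C. K m) * norm x"
      using m(1) C(2) K(1) C(1)
      by (intro mult_right_mono member_le_sum) (auto simp del: mem_sphere_0 intro!: less_imp_le)
    finally show ?thesis .
  qed
  then show ?thesis by blast
qed

lemma bounded_clinear_weighted_mean: "bounded_clinear (weighted_mean r w)"
proof -
  have add: "weighted_mean r w (x + y) = weighted_mean r w x + weighted_mean r w y" for x y
  proof -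
    have "weighted_mean r w (x + y) = circle_mean r (\<lambda>m. w m *\<^sub>C R m x + w m *\<^sub>C R m y)"
      unfolding weighted_mean_def using sphere_punctured_disc[OF r] r
      by (intro circle_mean_cong) (auto simp: subset_iff bounded_clinear_add[OF R_bounded_clinear] scaleC_add_right)
    then show ?thesis
      unfolding weighted_mean_def using r by (simp add: circle_mean_add continuous_on_weighted)
  qed
  have sc: "weighted_mean r w (c *\<^sub>C x) = c *\<^sub>C weighted_mean r w x" for c x
    by (rule weighted_mean_commute[symmetric])
      (auto simp: bounded_clinear_scaleC_left bounded_clinear_scaleC[OF R_bounded_clinear])
  obtain K where K: "\<And>m x. m \<in> sphere 0 r \<Longrightarrow> norm (R m x) \<le> K * norm x" using R_sphere_bound by blast
  have "bounded (w ` sphere 0 r)" using w by (intro compact_imp_bounded compact_continuous_image) auto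
  then obtain W where W: "\<And>m. m \<in> sphere 0 r \<Longrightarrow> cmod (w m) \<le> W"
    unfolding bounded_iff by blast
  have "norm (weighted_mean r w x) \<le> W * K * norm x" for x
    unfolding weighted_mean_def
  proof (rule norm_circle_mean_le[OF continuous_on_weighted])
    fix m :: complex assume m: "m \<in> sphere 0 r"
    have "norm (w m *\<^sub>C R m x) \<le> W * (K * norm x)"
      unfolding norm_scaleC
      by (intro mult_mono W[OF m] K[OF m] order_trans[OF norm_ge_zero W[OF m]] norm_ge_zero)
    then show "norm (w m *\<^sub>C R m x) \<le> W * K * norm x" by (simp add: mult.assoc)
  qed (use r in simp)
  then have "bounded_linear (weighted_mean r w)"
    by (intro bounded_linear_intro[of _ "W * K"] add)
      (auto simp: sc mult.commute simp flip: scaleC_of_real)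
  then show ?thesis using sc by (simp add: bounded_clinear_def)
qed

end

lemma weighted_means_commute:
  assumes "0 < r" "r < d" "continuous_on (sphere 0 r) w" "0 < s" "s < d" "continuous_on (sphere 0 s) v"
  shows "weighted_mean r w (weighted_mean s v x) = weighted_mean s v (weighted_mean r w x)"
proof (rule weighted_mean_commute[OF assms(4-6)])
  show "bounded_clinear (weighted_mean r w)" using assms by (intro bounded_clinear_weighted_mean)
  show "weighted_mean r w (R m x) = R m (weighted_mean r w x)" if "m \<in> punctured_disc" for m x
    using weighted_mean_commute[OF assms(1-3) R_bounded_clinear[OF that]] R_commute[OF that] by simp
qed

lemma weighted_mean_T:
  assumes "0 < r" "r < d" "continuous_on (sphere 0 r) w"
  shows "T (weighted_mean r w x) = weighted_mean r w (T x)"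
  using T_R R_T by (intro weighted_mean_commute[OF assms] T) auto

definition riesz_projection :: "real \<Rightarrow> 'a \<Rightarrow> 'a"
  where "riesz_projection r = weighted_mean r uminus"

lemma riesz_projection_eq: "riesz_projection r x = circle_mean r (\<lambda>m. (- m) *\<^sub>C R m x)"
  by (simp add: riesz_projection_def weighted_mean_def)

lemma continuous_on_pole:
  "cmod n \<noteq> r \<Longrightarrow> continuous_on (sphere 0 r) (\<lambda>m. m / (m - n))"
  by (intro continuous_intros) auto

lemma T_weighted_mean_const:
  assumes r: "0 < r" "r < d"
  shows "T (weighted_mean r (\<lambda>_. 1) x) = x - riesz_projection r x"
proof -
  have c1: "continuous_on (sphere 0 r) (\<lambda>_. 1 :: complex)" by simp
  have cu: "continuous_on (sphere 0 r) (uminus :: complex \<Rightarrow> complex)" by (intro continuous_intros)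
  have "T (weighted_mean r (\<lambda>_. 1) x) = circle_mean r (\<lambda>m. T (1 *\<^sub>C R m x))"
    unfolding weighted_mean_def
    using circle_mean_linear[OF continuous_on_weighted[OF r c1] _ bounded_clinear_linear[OF T], symmetric] r by simp
  also have "\<dots> = circle_mean r (\<lambda>m. x + - ((- m) *\<^sub>C R m x))"
    using r sphere_punctured_disc[OF r] by (intro circle_mean_cong) (auto simp: scaleC_one T_R subset_iff)
  also have "\<dots> = circle_mean r (\<lambda>_. x) + circle_mean r (\<lambda>m. - ((- m) *\<^sub>C R m x))"
    using r continuous_on_weighted[OF r cu] by (intro circle_mean_add continuous_on_minus) auto
  also have "circle_mean r (\<lambda>m. - ((- m) *\<^sub>C R m x)) = - riesz_projection r x"
    unfolding riesz_projection_eq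
    using r circle_mean_linear[OF continuous_on_weighted[OF r cu], where L = uminus]
    by (simp add: bounded_linear_minus bounded_linear_ident)
  finally show ?thesis by (simp add: circle_mean_const)
qed

text \<open>The scalar mean on the right is \<open>1\<close> or \<open>0\<close> according to whether \<open>n\<close> is inside or outside the circle.\<close>
lemma shift_op_weighted_mean_pole:
  assumes r: "0 < r" "r < d" and n: "cmod n \<noteq> r"
  shows "shift_op T n (weighted_mean r (\<lambda>m. m / (m - n)) x) =
    circle_mean r (\<lambda>m. m / (m - n)) *\<^sub>C x - riesz_projection r x"
proof -
  let ?w = "\<lambda>m. m / (m - n)"
  have cw: "continuous_on (sphere 0 r) ?w" using n by (rule continuous_on_pole)
  have cu: "continuous_on (sphere 0 r) (uminus :: complex \<Rightarrow> complex)" by (intro continuous_intros)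
  have "shift_op T n (weighted_mean r ?w x) = circle_mean r (\<lambda>m. shift_op T n (?w m *\<^sub>C R m x))"
    unfolding weighted_mean_def
    using circle_mean_linear[OF continuous_on_weighted[OF r cw] _
        bounded_clinear_linear[OF bounded_clinear_shift_op[OF T]], symmetric] r by simp
  also have "\<dots> = circle_mean r (\<lambda>m. ?w m *\<^sub>C x + - ((- m) *\<^sub>C R m x))"
  proof (rule circle_mean_cong)
    fix m :: complex assume m: "m \<in> sphere 0 r"
    then have "m \<in> punctured_disc" "m - n \<noteq> 0" using sphere_punctured_disc[OF r] n by auto
    have "shift_op T n (R m x) = x + (m - n) *\<^sub>C R m x"
      by (simp add: shift_op_def T_R[OF \<open>m \<in> punctured_disc\<close>] scaleC_diff_left)
    then show "shift_op T n (?w m *\<^sub>C R m x) = ?w m *\<^sub>C x + - ((- m) *\<^sub>C R m x)"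
      using \<open>m - n \<noteq> 0\<close>
      by (simp add: bounded_clinear_scaleC[OF bounded_clinear_shift_op[OF T]] scaleC_add_right scaleC_scaleC)
  qed (use r in simp)
  also have "\<dots> = circle_mean r (\<lambda>m. ?w m *\<^sub>C x) + circle_mean r (\<lambda>m. - ((- m) *\<^sub>C R m x))"
    using r by (intro circle_mean_add continuous_on_minus[OF continuous_on_weighted[OF r cu]]
        continuous_on_scaleC[OF cw] continuous_on_const) simp
  also have "circle_mean r (\<lambda>m. - ((- m) *\<^sub>C R m x)) = - riesz_projection r x"
    unfolding riesz_projection_eq
    using r circle_mean_linear[OF continuous_on_weighted[OF r cu], where L = uminus]
    by (simp add: bounded_linear_minus bounded_linear_ident)
  also have "circle_mean r (\<lambda>m. ?w m *\<^sub>C x) = circle_mean r ?w *\<^sub>C x"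
    using cw r by (intro circle_mean_scaleC) auto
  finally show ?thesis by simp
qed

lemma has_derivative_R:
  assumes "m \<in> punctured_disc"
  shows "((\<lambda>m. R m x) has_derivative (\<lambda>h. h *\<^sub>C R m (R m x))) (at m)"
proof (rule has_derivative_of_difference_quotient[OF open_punctured_disc assms, where g = "\<lambda>n. R n (R m x)"])
  show "R n x - R m x = (n - m) *\<^sub>C R n (R m x)" if "n \<in> punctured_disc" for n
    using that assms by (rule resolvent_identity)
  show "continuous_on punctured_disc (\<lambda>n. R n (R m x))"
    by (intro continuous_on_R_compose continuous_intros) auto
qed

lemma riesz_projection_radius_independent:
  assumes "0 < r" "r < d" "0 < s" "s < d"
  shows "riesz_projection r x = riesz_projection s x"
  unfolding riesz_projection_eq
proof (rule circle_mean_radius_independent[where a = 0 and b = d])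
  fix m assume m: "0 < cmod m" "cmod m < d"
  then have "m \<in> punctured_disc" by (simp add: punctured_disc_def)
  have "((\<lambda>m. - m) has_derivative (\<lambda>h. - h)) (at m)" by (intro derivative_eq_intros) auto
  from bounded_bilinear.FDERIV[OF bounded_bilinear_scaleC this has_derivative_R[OF \<open>m \<in> punctured_disc\<close>, of x]]
  show "((\<lambda>m. (- m) *\<^sub>C R m x) has_derivative
      (\<lambda>h. h *\<^sub>C (- (m *\<^sub>C R m (R m x)) - R m x))) (at m)"
    by (simp add: scaleC_diff_right scaleC_scaleC mult.commute)
next
  have "continuous_on punctured_disc (\<lambda>m. - (m *\<^sub>C R m (R m x)) - R m x)"
    by (intro continuous_on_R_compose continuous_on_scaleC continuous_intros) auto
  then show "continuous_on {m. 0 < cmod m \<and> cmod m < d} (\<lambda>m. - (m *\<^sub>C R m (R m x)) - R m x)"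
    by (simp add: punctured_disc_def)
qed (use assms in auto)

text \<open>Use a second circle of larger radius \<open>s\<close>. For \<open>m\<close> on the smaller circle the vector
  \<open>R m (x - P x)\<close> is a Cauchy transform over the larger one, so \<open>P (x - P x)\<close> becomes a double mean.
  In the other order of integration the inner mean is that of \<open>m / (m - n)\<close> with its pole \<open>n\<close> outside,
  hence \<open>0\<close>.\<close>
lemma riesz_projection_idempotent:
  assumes r: "0 < r" "r < d"
  shows "riesz_projection r (riesz_projection r x) = riesz_projection r x"
proof -
  define s where "s = (r + d) / 2"
  have s: "0 < s" "r < s" "s < d" using r by (simp_all add: s_def)
  let ?P = "riesz_projection r"
  define y where "y = x - riesz_projection s x"
  have cu: "continuous_on (sphere 0 r) (uminus :: complex \<Rightarrow> complex)" by (intro continuous_intros)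
  define F where "F m n = (- m * n / (n - m)) *\<^sub>C R n x" for m n
  have inner: "circle_mean s (F m) = (- m) *\<^sub>C R m y" if m: "m \<in> sphere 0 r" for m
  proof -
    have mD: "m \<in> punctured_disc" and ms: "cmod m < s" using m sphere_punctured_disc[OF r] s by auto
    have cw: "continuous_on (sphere 0 s) (\<lambda>n. n / (n - m))" using ms by (intro continuous_on_pole) simp
    have "weighted_mean s (\<lambda>n. n / (n - m)) x =
        R m (shift_op T m (weighted_mean s (\<lambda>n. n / (n - m)) x))"
      by (simp only: R_shift_op[OF mD])
    also have "\<dots> = R m y"
      using shift_op_weighted_mean_pole[OF s(1,3), of m x] circle_mean_pole_inside[OF ms] ms
      by (simp add: y_def scaleC_one)
    finally have eq: "circle_mean s (\<lambda>n. (n / (n - m)) *\<^sub>C R n x) = R m y"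
      by (simp only: weighted_mean_def)
    have "circle_mean s (F m) = circle_mean s (\<lambda>n. (- m) *\<^sub>C ((n / (n - m)) *\<^sub>C R n x))"
      by (simp add: F_def[abs_def] scaleC_scaleC)
    also have "\<dots> = (- m) *\<^sub>C R m y"
      unfolding eq[symmetric] using s continuous_on_weighted[OF s(1,3) cw]
      by (intro circle_mean_linear bounded_clinear_linear[OF bounded_clinear_scaleC_left]) auto
    finally show ?thesis .
  qed
  have outer: "circle_mean r (\<lambda>m. F m n) = 0" if n: "n \<in> sphere 0 s" for n
  proof -
    have nr: "r < cmod n" using n s by simp
    have cw: "continuous_on (sphere 0 r) (\<lambda>m. m / (m - n))" using nr by (intro continuous_on_pole) simp
    have "circle_mean r (\<lambda>m. F m n) = circle_mean r (\<lambda>m. (m / (m - n)) *\<^sub>C (n *\<^sub>C R n x))"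
    proof (rule circle_mean_cong)
      fix m :: complex assume "m \<in> sphere 0 r"
      then have "m \<noteq> n" using nr by auto
      then have "- m * n / (n - m) = m / (m - n) * n" by (simp add: field_simps)
      then show "F m n = (m / (m - n)) *\<^sub>C (n *\<^sub>C R n x)" by (simp add: F_def scaleC_scaleC)
    qed (use r in simp)
    also have "\<dots> = circle_mean r (\<lambda>m. m / (m - n)) *\<^sub>C (n *\<^sub>C R n x)"
      using r cw by (intro circle_mean_scaleC) auto
    finally show ?thesis using circle_mean_pole_outside[OF r(1) nr] by simp
  qed
  have cF: "continuous_on (sphere 0 r \<times> sphere 0 s) (\<lambda>(m, n). F m n)"
  proof -
    have "continuous_on (sphere 0 r \<times> sphere 0 s)
        (\<lambda>p. (- fst p * snd p / (snd p - fst p)) *\<^sub>C R (snd p) x)"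
      using s sphere_punctured_disc[OF s(1,3)]
      by (intro continuous_on_scaleC continuous_on_R_compose continuous_intros) auto
    then show ?thesis by (simp add: F_def case_prod_beta')
  qed
  have "?P y = circle_mean r (\<lambda>m. circle_mean s (F m))"
    unfolding riesz_projection_eq using inner r by (intro circle_mean_cong) auto
  also have "\<dots> = circle_mean s (\<lambda>n. circle_mean r (\<lambda>m. F m n))"
    using cF r s by (intro circle_mean_swap) auto
  also have "\<dots> = circle_mean s (\<lambda>n. 0)"
    using outer s by (intro circle_mean_cong) auto
  finally have "?P y = 0" by (simp add: circle_mean_const)
  moreover have "y = x - ?P x"
    using riesz_projection_radius_independent[OF r s(1,3)] by (simp add: y_def)
  moreover have "bounded_clinear ?P"
    unfolding riesz_projection_def by (rule bounded_clinear_weighted_mean[OF r cu])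
  ultimately show ?thesis by (simp add: bounded_clinear_diff)
qed

text \<open>The kernel of the Riesz projection carries the invertible part, with inverse the mean of the
  resolvent. On its range \<open>T - n\<close> is inverted, for each \<open>n \<noteq> 0\<close>, by the Cauchy transform over a circle
  with radius smaller than \<open>cmod n\<close>; this circle depends on \<open>n\<close>, but the projection does not.\<close>
lemma pseudo_fredholm_punctured_resolvent: "pseudo_fredholm T"
proof -
  define r where "r = d / 2"
  have r: "0 < r" "r < d" using d by (simp_all add: r_def)
  let ?P = "riesz_projection r"
  have cu: "continuous_on (sphere 0 s) (uminus :: complex \<Rightarrow> complex)" for s by (intro continuous_intros)
  have P: "bounded_clinear ?P"
    unfolding riesz_projection_def by (rule bounded_clinear_weighted_mean[OF r cu])
  have PP: "?P (?P x) = ?P x" for x using r by (rule riesz_projection_idempotent)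
  have TP: "T (?P x) = ?P (T x)" for x
    unfolding riesz_projection_def by (rule weighted_mean_T[OF r cu])
  have PW: "?P (weighted_mean s w x) = weighted_mean s w (?P x)"
    if "0 < s" "s < d" "continuous_on (sphere 0 s) w" for s w x
    unfolding riesz_projection_def by (rule weighted_means_commute[OF r cu that])
  define M where "M = {x. ?P x = 0}"
  define N where "N = {x. ?P x = x}"
  have cP: "continuous_on UNIV ?P" using P by (rule bounded_clinear_continuous_on)
  have M: "closed_invariant_subspace T M"
    unfolding closed_invariant_subspace_def M_def
    using closed_Collect_eq[OF cP continuous_on_const]
    by (auto simp: complex_vector.subspace_def bounded_clinear_zero[OF P] bounded_clinear_add[OF P]
        bounded_clinear_scaleC[OF P] bounded_clinear_zero[OF T] simp flip: TP)
  have N: "closed_invariant_subspace T N"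
    unfolding closed_invariant_subspace_def N_def
    using closed_Collect_eq[OF cP continuous_on_id]
    by (auto simp: complex_vector.subspace_def bounded_clinear_zero[OF P] bounded_clinear_add[OF P]
        bounded_clinear_scaleC[OF P] simp flip: TP)
  have "x \<in> {x + y | x y. x \<in> M \<and> y \<in> N}" for x
  proof -
    have "x - ?P x \<in> M" "?P x \<in> N" by (simp_all add: M_def N_def PP bounded_clinear_diff[OF P])
    moreover have "x = (x - ?P x) + ?P x" by simp
    ultimately show ?thesis by blast
  qed
  then have sum: "{x + y | x y. x \<in> M \<and> y \<in> N} = UNIV" by blast
  have int: "M \<inter> N = {0}" by (auto simp: M_def N_def bounded_clinear_zero[OF P])
  let ?G = "weighted_mean r (\<lambda>_. 1)"
  have TG: "T (?G x) = x" "?G x \<in> M" "?G (T x) = x" if "x \<in> M" for x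
  proof -
    have x: "?P x = 0" using that by (simp add: M_def)
    show "T (?G x) = x" using T_weighted_mean_const[OF r, of x] x by simp
    show "?G (T x) = x" using T_weighted_mean_const[OF r, of x] x weighted_mean_T[OF r, of "\<lambda>_. 1" x] by simp
    show "?G x \<in> M"
      using PW[OF r, of "\<lambda>_. 1" x] x bounded_clinear_zero[OF bounded_clinear_weighted_mean[OF r, of "\<lambda>_. 1"]]
      by (simp add: M_def)
  qed
  have G0: "?G 0 = 0" using bounded_clinear_zero[OF bounded_clinear_weighted_mean[OF r, of "\<lambda>_. 1"]] by simp
  have "T ` M = M" using TG M by (force simp: closed_invariant_subspace_def)
  then have "closed (T ` M)" using M by (simp add: closed_invariant_subspace_def)
  moreover have "{x \<in> M. T x = 0} \<subseteq> (\<Inter>n. (T ^^ n) ` M)"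
  proof (intro subsetI INT_I)
    fix x n assume "x \<in> {x \<in> M. T x = 0}"
    then have "x = 0" using TG(3)[of x] G0 by simp
    moreover have "(T ^^ n) 0 = 0" using bounded_clinear_zero[OF bounded_clinear_funpow[OF T]] .
    moreover have "0 \<in> M" by (simp add: M_def bounded_clinear_zero[OF P])
    ultimately show "x \<in> (T ^^ n) ` M" by (metis image_eqI)
  qed
  ultimately have "semi_regular_on M T" by (simp add: semi_regular_on_def)
  moreover have "quasinilpotent_on N T"
  proof -
    have "invertible_on N (shift_op T n)" if n: "n \<noteq> 0" for n
    proof -
      define s where "s = min r (cmod n / 2)"
      have s: "0 < s" "s < d" "s < cmod n" using r n by (auto simp: s_def min_def)
      let ?w = "\<lambda>m. m / (m - n)"
      have cw: "continuous_on (sphere 0 s) ?w" using s by (intro continuous_on_pole) simp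
      define S where "S x = - weighted_mean s ?w x" for x
      have W: "bounded_clinear (weighted_mean s ?w)" by (rule bounded_clinear_weighted_mean[OF s(1,2) cw])
      have "shift_op T n (S x) = riesz_projection s x" for x
        using shift_op_weighted_mean_pole[OF s(1,2), of n x] circle_mean_pole_outside[OF s(1,3)] s
        by (simp add: S_def bounded_clinear_minus[OF bounded_clinear_shift_op[OF T]])
      then have TS: "shift_op T n (S x) = x" if "x \<in> N" for x
        using that riesz_projection_radius_independent[OF s(1,2) r, of x] by (simp add: N_def)
      have ST: "S (shift_op T n x) = shift_op T n (S x)" for x
        using weighted_mean_T[OF s(1,2) cw, of x]
        by (simp add: S_def shift_op_def bounded_clinear_diff[OF W] bounded_clinear_scaleC[OF W]
            bounded_clinear_minus[OF T])
      have SN: "S x \<in> N" if "x \<in> N" for x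
        using that PW[OF s(1,2) cw, of x] by (simp add: S_def N_def bounded_clinear_minus[OF P])
      obtain K where "\<And>x. norm (weighted_mean s ?w x) \<le> K * norm x"
        using bounded_clinear_bound[OF W] by blast
      then have "\<forall>x\<in>N. norm (S x) \<le> K * norm x" by (simp add: S_def)
      then show ?thesis unfolding invertible_on_def using TS ST SN by (intro exI[of _ S]) auto
    qed
    then show ?thesis by (auto simp: quasinilpotent_on_def spectrum_on_def)
  qed
  ultimately show ?thesis unfolding pseudo_fredholm_def using M N sum int by blast
qed

end

lemma isolated_pseudo_fredholm:
  fixes T :: "'a::complex_banach \<Rightarrow> 'a"
  assumes T: "bounded_clinear T" and l: "\<not> l islimpt spectrum_on UNIV T"
  shows "pseudo_fredholm (shift_op T l)"
proof -
  let ?S = "shift_op T l"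
  obtain d where d: "d > 0" "\<And>m. m \<noteq> l \<Longrightarrow> dist m l < d \<Longrightarrow> m \<notin> spectrum_on UNIV T"
    using l unfolding islimpt_approachable by blast
  have "\<exists>R. bounded_clinear R \<and> (\<forall>x. R (shift_op ?S m x) = x) \<and> (\<forall>x. shift_op ?S m (R x) = x)"
    if m: "0 < cmod m" "cmod m < d" for m
  proof -
    have "l + m \<notin> spectrum_on UNIV T" using m by (intro d) (auto simp: dist_norm)
    then have "invertible_on UNIV (shift_op ?S m)" by (simp add: spectrum_on_def shift_op_shift_op)
    then obtain R K where R: "\<And>x. R (shift_op ?S m x) = x" "\<And>x. shift_op ?S m (R x) = x"
      and K: "\<And>x. norm (R x) \<le> K * norm x"
      unfolding invertible_on_def by auto
    then show ?thesis
      using bounded_clinear_inverse[OF bounded_clinear_shift_op[OF bounded_clinear_shift_op[OF T]] R K] by blast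
  qed
  then obtain R where R: "\<And>m. 0 < cmod m \<Longrightarrow> cmod m < d \<Longrightarrow> bounded_clinear (R m) \<and>
      (\<forall>x. R m (shift_op ?S m x) = x) \<and> (\<forall>x. shift_op ?S m (R m x) = x)"
    by metis
  interpret punctured_resolvent ?S R d
    by unfold_locales (use bounded_clinear_shift_op[OF T] d(1) R in auto)
  show ?thesis by (rule pseudo_fredholm_punctured_resolvent)
qed

text \<open>For tame operators the generalized Kato spectrum is thus the set of accumulation points of the
  ordinary spectrum, and the union formula is inherited from the one for ordinary spectra.\<close>
lemma gK_spectrum_tame:
  fixes T :: "'a::complex_banach \<Rightarrow> 'a"
  assumes "bounded_clinear T" "tame T"
  shows "gK_spectrum T = {l. l islimpt spectrum_on UNIV T}"
  unfolding gK_spectrum_def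
  using pseudo_fredholm_isolated[OF assms] isolated_pseudo_fredholm[OF assms(1)] by blast

lemma gK_spectrum_upper_triangular_op:
  fixes A :: "'a::complex_banach \<Rightarrow> 'a" and B :: "'b::complex_banach \<Rightarrow> 'b"
  assumes A: "bounded_clinear A" "tame A" and B: "bounded_clinear B" "tame B" and C: "bounded_clinear C"
  shows "gK_spectrum (upper_triangular_op A B C) = gK_spectrum A \<union> gK_spectrum B"
  using gK_spectrum_tame[OF A] gK_spectrum_tame[OF B]
    gK_spectrum_tame[OF bounded_clinear_upper_triangular_op[OF A(1) B(1) C] tame_upper_triangular_op[OF A B C]]
  by (auto simp: spectrum_upper_triangular_op[OF A B C] islimpt_Un)

theorem corollary4p2:
  fixes A :: "'a::complex_banach \<Rightarrow> 'a" and B :: "'b::complex_banach \<Rightarrow> 'b"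
  assumes "bounded_clinear A" and "bounded_clinear B"
  shows "(decomposable_op A \<and> decomposable_op B \<longrightarrow>
           (\<forall>C :: 'b \<Rightarrow> 'a. bounded_clinear C \<longrightarrow>
              gK_spectrum (upper_triangular_op A B C) = gK_spectrum A \<union> gK_spectrum B)) \<and>
         ((algebraic_op A \<or> compact_op A) \<and> (algebraic_op B \<or> compact_op B) \<longrightarrow>
           (\<forall>C :: 'b \<Rightarrow> 'a. bounded_clinear C \<longrightarrow>
              gK_spectrum (upper_triangular_op A B C) = gK_spectrum A \<union> gK_spectrum B))"
  using gK_spectrum_upper_triangular_op[OF assms(1) _ assms(2)]
    decomposable_tame[OF assms(1)] decomposable_tame[OF assms(2)]
    algebraic_tame[OF assms(1)] algebraic_tame[OF assms(2)]
    compact_tame[OF assms(1)] compact_tame[OF assms(2)]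
  by blast

end
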